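(* Let $\Gamma$ be a countable group. Assume that $N\lhd\Gamma$ is a normal subgroup contained in the FC-hypercentre of $\Gamma$ and let $\phi:\Gamma\to\Gamma/N$ be the quotient map. Let $\nu$ be a finitely supported symmetric probability measure on $\Gamma/N$ whose support generates $\Gamma/N$. Let $\mu$ be any probability measure on $\Gamma$ such that $\operatorname{supp}\mu\cap N$ generates $N$ and such that $\mu=\mu_1+\mu_2$, where $\mu_1,\mu_2$ are non-negative measures satisfying: - $t:=\|\mu_2\|_{\ell^1}>0$ and $\phi_*\mu_2$ is a lazy version of $t\nu$, i.e. $\phi_*\mu_2=t\big(s\delta_e+(1-s)\nu\big)$ for some $s\in[0,1)$; - $\mu_1$ is supported in $N$, and for every ordinal $\lambda$ the image of $\operatorname{supp}\mu_1\cap Z_{FC}^{\lambda+1}(\Gamma)$ in $\Gamma/Z_{FC}^{\lambda}(\Gamma)$ is invariant under conjugation. Assume that at least one of the following holds: (a) $N$ is finitely generated; or (b) there exists $n\geq 1$ such that for every ordinal $\lambda$ the set $\operatorname{supp}(\mu^{*n})\cap N\cap Z_{FC}^\lambda(\Gamma)$ generates $N\cap Z_{FC}^\lambda(\Gamma)$. Then $\Gamma$ is $\mu$-Liouville if and only if $\Gamma/N$ is $\nu$-Liouville.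
   Context: For a probability measure $P$ on a countable (discrete) group $G$ and a bounded function $f:G\to\mathbb{R}$, put $(f*P)(\gamma)=\sum_{y\in G} f(\gamma y^{-1})P(y)$. The function $f$ is $P$-harmonic if $f*P=f$. The group $G$ is $P$-Liouville if every bounded $P$-harmonic function on $G$ is constant. $\mu^{*n}$ is the $n$-fold convolution power of $\mu$. A measure $\nu$ is symmetric if $\nu(x)=\nu(x^{-1})$ for all $x$. "Generates" means generates as a group. The push-forward of $\mu$ by $\phi$ is $\phi_*\mu(x)=\mu(\phi^{-1}(x))$, and $\delta_e$ is the Dirac mass at the identity. FC-hypercentre: the FC-centre $Z_{FC}(G)$ of a group $G$ is the subgroup of elements with finite conjugacy class. Put $Z_{FC}^0(\Gamma)=\{e\}$. For each ordinal $\lambda$, $Z_{FC}^{\lambda+1}(\Gamma)$ is the preimage in $\Gamma$ of $Z_{FC}(\Gamma/Z_{FC}^\lambda(\Gamma))$. For a limit ordinal $\beta$, $Z_{FC}^\beta(\Gamma)=\bigcup_{\lambda<\beta}Z_{FC}^\lambda(\Gamma)$. This sequence stabilises at some ordinal $\alpha$, and $Z_{FC}^\alpha(\Gamma)$ is the FC-hypercentre of $\Gamma$. *)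

theory Defs
  imports "HOL-Algebra.Generated_Groups" "HOL-Probability.Probability"
begin

section \<open>Ordinals\<close>

text \<open>
  Ordinals are elements of a type of class wellorder. For the transfinite series of
  a countable group the type below, a copy of \<open>\<omega>\<^sub>1\<close>, provides all the ordinals that matter:
  see the stabilisation lemma \<open>fc_series_stabilises\<close>.
\<close>

typedef countable_ordinal = "UNIV :: nat suc set" ..

lemma card_order_natLeq: "card_order natLeq"
  using natLeq_Card_order by (simp add: Field_natLeq)

lemma well_order_card_suc_natLeq: "well_order (card_suc natLeq)"
  using card_order_card_suc[OF card_order_natLeq] card_order_on_well_order_on by blast

instantiation countable_ordinal :: ord
begin

definition less_eq_countable_ordinal :: "countable_ordinal \<Rightarrow> countable_ordinal \<Rightarrow> bool" where
  "x \<le> y \<longleftrightarrow> (Rep_countable_ordinal x, Rep_countable_ordinal y) \<in> card_suc natLeq"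

definition less_countable_ordinal :: "countable_ordinal \<Rightarrow> countable_ordinal \<Rightarrow> bool" where
  "x < y \<longleftrightarrow> x \<le> y \<and> x \<noteq> (y :: countable_ordinal)"

instance ..

end

instance countable_ordinal :: wellorder
proof -
  let ?R = "card_suc natLeq" and ?rep = Rep_countable_ordinal
  note wo = well_order_card_suc_natLeq
  have refl: "refl ?R" and trans: "trans ?R" and antisym: "antisym ?R" and total: "total ?R"
    and wf: "wf (?R - Id)"
    using wo unfolding well_order_on_def linear_order_on_def partial_order_on_def preorder_on_def
    by auto
  have inj: "?rep x = ?rep y \<longleftrightarrow> x = y" for x y
    by (rule Rep_countable_ordinal_inject)
  have wf': "wf {(x, y). x < (y :: countable_ordinal)}"
    by (rule wf_subset[OF wf_inv_image[OF wf, of ?rep]])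
      (auto simp: inv_image_def less_countable_ordinal_def less_eq_countable_ordinal_def inj)
  show "OFCLASS(countable_ordinal, wellorder_class)"
  proof intro_classes
    fix x y z :: countable_ordinal
    show "x \<le> x"
      using refl by (auto simp: less_eq_countable_ordinal_def refl_on_def)
    show "x \<le> y \<Longrightarrow> y \<le> z \<Longrightarrow> x \<le> z"
      using trans by (auto simp: less_eq_countable_ordinal_def elim: transE)
    show anti: "x \<le> y \<Longrightarrow> y \<le> x \<Longrightarrow> x = y"
      using antisym inj by (auto simp: less_eq_countable_ordinal_def antisym_def)
    show "(x < y) = (x \<le> y \<and> \<not> y \<le> x)"
      using antisym inj refl
      by (auto simp: less_countable_ordinal_def less_eq_countable_ordinal_def antisym_def refl_on_def)
    show "x \<le> y \<or> y \<le> x"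
      using total refl inj by (force simp: less_eq_countable_ordinal_def total_on_def refl_on_def)
  next
    fix P :: "countable_ordinal \<Rightarrow> bool" and a
    assume "\<And>x. (\<And>y. y < x \<Longrightarrow> P y) \<Longrightarrow> P x"
    then show "P a"
      using wf_induct_rule[OF wf', of P a] by auto
  qed
qed

lemma uncountable_countable_ordinal:
  includes cardinal_syntax
  shows "uncountable (UNIV :: countable_ordinal set)"
proof
  assume "countable (UNIV :: countable_ordinal set)"
  then have "countable (range Rep_countable_ordinal)"
    by (rule countable_image)
  then have "countable (UNIV :: nat suc set)"
    using type_definition.Rep_range[OF type_definition_countable_ordinal] by simp
  then have "|UNIV :: nat suc set| \<le>o natLeq"
    by (meson card_of_nat card_of_ordLeq countableE ordLeq_ordIso_trans top_greatest)
  moreover have "|UNIV :: nat suc set| =o card_suc natLeq"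
    using card_of_unique card_order_card_suc[OF card_order_natLeq] ordIso_symmetric by blast
  ultimately show False
    using card_suc_greater[OF card_order_natLeq] not_ordLess_ordLeq ordIso_ordLeq_trans
      ordIso_symmetric by blast
qed

lemma countable_below_countable_ordinal:
  includes cardinal_syntax
  shows "countable {..<(\<alpha> :: countable_ordinal)}"
proof -
  let ?r = "card_suc natLeq" and ?a = "Rep_countable_ordinal \<alpha>"
  have co: "Card_order ?r"
    by (rule Card_order_card_suc[OF card_order_natLeq])
  have "|underS ?r ?a| <o ?r"
    by (rule card_of_underS[OF co]) (simp add: Field_card_suc)
  moreover have "?r =o cardSuc natLeq"
    using cardSuc_ordIso_card_suc[OF card_order_natLeq] ordIso_symmetric by blast
  ultimately have "|underS ?r ?a| <o cardSuc natLeq"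
    using ordLess_ordIso_trans by blast
  then have "|underS ?r ?a| \<le>o natLeq"
    using cardSuc_ordLeq_ordLess[OF natLeq_Card_order card_of_Card_order] by blast
  then have "countable (underS ?r ?a)"
    using card_of_nat card_of_ordLeq countableI ordIso_symmetric ordLeq_ordIso_trans
    by (metis countable_def)
  moreover have "Rep_countable_ordinal ` {..<\<alpha>} \<subseteq> underS ?r ?a"
    by (auto simp: underS_def less_countable_ordinal_def less_eq_countable_ordinal_def
        Rep_countable_ordinal_inject)
  ultimately have "countable (Rep_countable_ordinal ` {..<\<alpha>})"
    by (rule countable_subset[rotated])
  then show ?thesis
    by (rule countable_image_inj_on) (simp add: inj_on_def Rep_countable_ordinal_inject)
qed

instance countable_ordinal :: no_top
proof
  fix \<alpha> :: countable_ordinal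
  show "\<exists>\<beta>. \<alpha> < \<beta>"
  proof (rule ccontr)
    assume "\<nexists>\<beta>. \<alpha> < \<beta>"
    then have "UNIV = insert \<alpha> {..<\<alpha>}"
      by (auto simp: not_less order_le_less)
    then show False
      using uncountable_countable_ordinal countable_below_countable_ordinal[of \<alpha>]
      by (metis countable_insert)
  qed
qed

definition osuc :: "'o::wellorder \<Rightarrow> 'o" where
  "osuc \<alpha> = (LEAST \<beta>. \<alpha> < \<beta>)"

lemma less_osuc: "\<alpha> < osuc (\<alpha> :: 'o::{wellorder, no_top})"
  unfolding osuc_def by (rule LeastI_ex) (rule gt_ex)

lemma less_osuc_iff: "\<beta> < osuc \<alpha> \<longleftrightarrow> \<beta> \<le> (\<alpha> :: 'o::{wellorder, no_top})"
  using less_osuc[of \<alpha>] not_less_Least[of \<beta> "\<lambda>\<beta>. \<alpha> < \<beta>"]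
  unfolding osuc_def by (meson le_less_trans not_le)


section \<open>The FC-hypercentre\<close>

definition fc_centre :: "('a, 'b) monoid_scheme \<Rightarrow> 'a set" where
  "fc_centre G =
     {x \<in> carrier G. finite {g \<otimes>\<^bsub>G\<^esub> x \<otimes>\<^bsub>G\<^esub> inv\<^bsub>G\<^esub> g | g. g \<in> carrier G}}"

definition fc_next :: "('a, 'b) monoid_scheme \<Rightarrow> 'a set \<Rightarrow> 'a set" where
  "fc_next G H = {x \<in> carrier G. H #>\<^bsub>G\<^esub> x \<in> fc_centre (G Mod H)}"

text \<open>
  In the middle case below, \<open>\<alpha>\<close> is the successor of the greatest ordinal below \<open>\<alpha>\<close>. The
  textbook form of the recursion is \<open>fc_series_zero\<close>, \<open>fc_series_osuc\<close>, \<open>fc_series_limit\<close>.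
\<close>

function fc_series :: "('a, 'b) monoid_scheme \<Rightarrow> 'o::wellorder \<Rightarrow> 'a set" where
  "fc_series G \<alpha> =
     (if \<forall>\<beta>. \<alpha> \<le> \<beta> then {\<one>\<^bsub>G\<^esub>}
      else if \<exists>\<beta><\<alpha>. \<forall>\<gamma><\<alpha>. \<gamma> \<le> \<beta> then fc_next G (fc_series G (GREATEST \<beta>. \<beta> < \<alpha>))
      else (\<Union>\<beta>\<in>{..<\<alpha>}. fc_series G \<beta>))"
  by auto
termination
proof (relation "inv_image {(\<beta>, \<alpha>). \<beta> < \<alpha>} snd")
  show "wf (inv_image {(\<beta>, \<alpha> :: 'o::wellorder). \<beta> < \<alpha>} snd)"
    by (intro wf_inv_image wf)
next
  fix G :: "('a, 'b) monoid_scheme" and \<alpha> :: "'o::wellorder"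
  assume "\<exists>\<beta><\<alpha>. \<forall>\<gamma><\<alpha>. \<gamma> \<le> \<beta>"
  then have "(GREATEST \<beta>. \<beta> < \<alpha>) < \<alpha>"
    by (metis GreatestI2_order)
  then show "((G, GREATEST \<beta>. \<beta> < \<alpha>), G, \<alpha>) \<in> inv_image {(\<beta>, \<alpha>). \<beta> < \<alpha>} snd"
    by simp
qed auto

declare fc_series.simps [simp del]

lemma fc_series_zero: "(\<And>\<beta>. \<alpha> \<le> \<beta>) \<Longrightarrow> fc_series G \<alpha> = {\<one>\<^bsub>G\<^esub>}"
  by (simp add: fc_series.simps)

lemma fc_series_osuc:
  fixes \<alpha> :: "'o::{wellorder, no_top}"
  shows "fc_series G (osuc \<alpha>) = fc_next G (fc_series G \<alpha>)"
proof -
  have "(GREATEST \<beta>. \<beta> < osuc \<alpha>) = \<alpha>"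
    by (rule Greatest_equality) (auto simp: less_osuc_iff)
  moreover have "\<not> (\<forall>\<beta>. osuc \<alpha> \<le> \<beta>)"
    using less_osuc[of \<alpha>] by (auto simp: not_le)
  moreover have "\<exists>\<beta><osuc \<alpha>. \<forall>\<gamma><osuc \<alpha>. \<gamma> \<le> \<beta>"
    by (auto simp: less_osuc_iff)
  ultimately show ?thesis
    by (subst fc_series.simps) (simp only: if_False if_True)
qed

lemma fc_series_limit:
  fixes \<alpha> :: "'o::{wellorder, no_top}"
  assumes "\<exists>\<beta>. \<beta> < \<alpha>" "\<And>\<beta>. \<beta> < \<alpha> \<Longrightarrow> osuc \<beta> < \<alpha>"
  shows "fc_series G \<alpha> = (\<Union>\<beta>\<in>{..<\<alpha>}. fc_series G \<beta>)"
proof -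
  have "\<not> (\<forall>\<beta>. \<alpha> \<le> \<beta>)"
    using assms(1) by (auto simp: not_le)
  moreover have "\<not> (\<exists>\<beta><\<alpha>. \<forall>\<gamma><\<alpha>. \<gamma> \<le> \<beta>)"
    using assms(2) less_osuc not_le by blast
  ultimately show ?thesis
    by (subst fc_series.simps) (simp only: if_False)
qed

lemma normal_fc_centre:
  assumes "group G"
  shows "fc_centre G \<lhd> G"
proof -
  interpret group G by fact
  let ?C = "\<lambda>x. {g \<otimes>\<^bsub>G\<^esub> x \<otimes>\<^bsub>G\<^esub> inv\<^bsub>G\<^esub> g | g. g \<in> carrier G}"
  have "?C \<one>\<^bsub>G\<^esub> \<subseteq> {\<one>\<^bsub>G\<^esub>}"
    by auto
  then have one: "finite (?C \<one>\<^bsub>G\<^esub>)"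
    using finite_subset by blast
  have inv: "finite (?C (inv\<^bsub>G\<^esub> x))" if "x \<in> carrier G" "finite (?C x)" for x
  proof (rule finite_subset)
    show "?C (inv\<^bsub>G\<^esub> x) \<subseteq> m_inv G ` ?C x"
    proof clarify
      fix g assume g: "g \<in> carrier G"
      then have "g \<otimes>\<^bsub>G\<^esub> inv\<^bsub>G\<^esub> x \<otimes>\<^bsub>G\<^esub> inv\<^bsub>G\<^esub> g = inv\<^bsub>G\<^esub> (g \<otimes>\<^bsub>G\<^esub> x \<otimes>\<^bsub>G\<^esub> inv\<^bsub>G\<^esub> g)"
        using that by (simp add: inv_mult_group m_assoc)
      then show "g \<otimes>\<^bsub>G\<^esub> inv\<^bsub>G\<^esub> x \<otimes>\<^bsub>G\<^esub> inv\<^bsub>G\<^esub> g \<in> m_inv G ` ?C x"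
        using g by blast
    qed
  qed (use that in blast)
  have mult: "finite (?C (x \<otimes>\<^bsub>G\<^esub> y))"
    if "x \<in> carrier G" "y \<in> carrier G" "finite (?C x)" "finite (?C y)" for x y
  proof (rule finite_subset)
    show "?C (x \<otimes>\<^bsub>G\<^esub> y) \<subseteq> (\<lambda>(a, b). a \<otimes>\<^bsub>G\<^esub> b) ` (?C x \<times> ?C y)"
    proof clarify
      fix g assume g: "g \<in> carrier G"
      have "inv\<^bsub>G\<^esub> g \<otimes>\<^bsub>G\<^esub> (g \<otimes>\<^bsub>G\<^esub> (y \<otimes>\<^bsub>G\<^esub> inv\<^bsub>G\<^esub> g)) = y \<otimes>\<^bsub>G\<^esub> inv\<^bsub>G\<^esub> g"
        using that g by (simp flip: m_assoc)
      then have "g \<otimes>\<^bsub>G\<^esub> (x \<otimes>\<^bsub>G\<^esub> y) \<otimes>\<^bsub>G\<^esub> inv\<^bsub>G\<^esub> g =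
          (g \<otimes>\<^bsub>G\<^esub> x \<otimes>\<^bsub>G\<^esub> inv\<^bsub>G\<^esub> g) \<otimes>\<^bsub>G\<^esub> (g \<otimes>\<^bsub>G\<^esub> y \<otimes>\<^bsub>G\<^esub> inv\<^bsub>G\<^esub> g)"
        using that g by (simp add: m_assoc)
      then show "g \<otimes>\<^bsub>G\<^esub> (x \<otimes>\<^bsub>G\<^esub> y) \<otimes>\<^bsub>G\<^esub> inv\<^bsub>G\<^esub> g \<in> (\<lambda>(a, b). a \<otimes>\<^bsub>G\<^esub> b) ` (?C x \<times> ?C y)"
        using g by (intro image_eqI[where x = "(_, _)"]) auto
    qed
  qed (use that in blast)
  have conj: "finite (?C (h \<otimes>\<^bsub>G\<^esub> x \<otimes>\<^bsub>G\<^esub> inv\<^bsub>G\<^esub> h))"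
    if "x \<in> carrier G" "h \<in> carrier G" "finite (?C x)" for x h
  proof (rule finite_subset)
    show "?C (h \<otimes>\<^bsub>G\<^esub> x \<otimes>\<^bsub>G\<^esub> inv\<^bsub>G\<^esub> h) \<subseteq> ?C x"
    proof clarify
      fix g assume g: "g \<in> carrier G"
      then have "g \<otimes>\<^bsub>G\<^esub> (h \<otimes>\<^bsub>G\<^esub> x \<otimes>\<^bsub>G\<^esub> inv\<^bsub>G\<^esub> h) \<otimes>\<^bsub>G\<^esub> inv\<^bsub>G\<^esub> g =
          (g \<otimes>\<^bsub>G\<^esub> h) \<otimes>\<^bsub>G\<^esub> x \<otimes>\<^bsub>G\<^esub> inv\<^bsub>G\<^esub> (g \<otimes>\<^bsub>G\<^esub> h)"
        using that by (simp add: inv_mult_group m_assoc)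
      then show "\<exists>k. g \<otimes>\<^bsub>G\<^esub> (h \<otimes>\<^bsub>G\<^esub> x \<otimes>\<^bsub>G\<^esub> inv\<^bsub>G\<^esub> h) \<otimes>\<^bsub>G\<^esub> inv\<^bsub>G\<^esub> g =
          k \<otimes>\<^bsub>G\<^esub> x \<otimes>\<^bsub>G\<^esub> inv\<^bsub>G\<^esub> k \<and> k \<in> carrier G"
        using g that by blast
    qed
  qed (use that in blast)
  have "subgroup (fc_centre G) G"
    unfolding fc_centre_def
    by (rule subgroupI) (use one inv mult in blast)+
  then show ?thesis
    unfolding normal_inv_iff using conj by (simp add: fc_centre_def)
qed

lemma normal_fc_next:
  assumes "H \<lhd> G"
  shows "fc_next G H \<lhd> G" and "H \<subseteq> fc_next G H"
proof -
  interpret normal H G by fact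
  interpret Q: group "G Mod H"
    by (rule factorgroup_is_group)
  interpret \<phi>: group_hom G "G Mod H" "\<lambda>x. H #>\<^bsub>G\<^esub> x"
    by unfold_locales (rule r_coset_hom_Mod)
  interpret C: normal "fc_centre (G Mod H)" "G Mod H"
    by (rule normal_fc_centre) (rule Q.group_axioms)
  have sub: "subgroup (fc_next G H) G"
  proof (rule subgroupI)
    have "\<one>\<^bsub>G\<^esub> \<in> fc_next G H"
      using C.one_closed \<phi>.hom_one unfolding fc_next_def by auto
    then show "fc_next G H \<noteq> {}"
      by blast
  next
    fix a b assume ab: "a \<in> fc_next G H" "b \<in> fc_next G H"
    show "inv\<^bsub>G\<^esub> a \<in> fc_next G H"
      using ab C.m_inv_closed \<phi>.hom_inv unfolding fc_next_def by auto
    show "a \<otimes>\<^bsub>G\<^esub> b \<in> fc_next G H"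
      using ab C.m_closed \<phi>.hom_mult unfolding fc_next_def by auto
  qed (auto simp: fc_next_def)
  show "fc_next G H \<lhd> G"
    unfolding normal_inv_iff
  proof (intro conjI ballI)
    fix x h assume xh: "x \<in> carrier G" "h \<in> fc_next G H"
    then have h: "h \<in> carrier G" "H #>\<^bsub>G\<^esub> h \<in> fc_centre (G Mod H)"
      by (auto simp: fc_next_def)
    have "H #>\<^bsub>G\<^esub> (x \<otimes>\<^bsub>G\<^esub> h \<otimes>\<^bsub>G\<^esub> inv\<^bsub>G\<^esub> x) =
        (H #>\<^bsub>G\<^esub> x) \<otimes>\<^bsub>G Mod H\<^esub> (H #>\<^bsub>G\<^esub> h) \<otimes>\<^bsub>G Mod H\<^esub> inv\<^bsub>G Mod H\<^esub> (H #>\<^bsub>G\<^esub> x)"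
      using xh h by (simp only: \<phi>.hom_mult \<phi>.hom_inv m_closed inv_closed)
    also have "\<dots> \<in> fc_centre (G Mod H)"
      using C.inv_op_closed2 \<phi>.hom_closed xh h by blast
    finally show "x \<otimes>\<^bsub>G\<^esub> h \<otimes>\<^bsub>G\<^esub> inv\<^bsub>G\<^esub> x \<in> fc_next G H"
      using xh h by (simp add: fc_next_def)
  qed (rule sub)
  show "H \<subseteq> fc_next G H"
  proof
    fix h assume h: "h \<in> H"
    then have "H #>\<^bsub>G\<^esub> h = \<one>\<^bsub>G Mod H\<^esub>"
      by (simp add: rcos_const)
    then show "h \<in> fc_next G H"
      using h C.one_closed by (simp add: fc_next_def)
  qed
qed

lemma normal_mono_fc_series:
  fixes \<alpha> :: "'o::wellorder"
  assumes "group G"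
  shows "fc_series G \<alpha> \<lhd> G \<and> (\<forall>\<beta>\<le>\<alpha>. fc_series G \<beta> \<subseteq> fc_series G \<alpha>)"
proof (induction \<alpha> rule: less_induct)
  case (less \<alpha>)
  interpret group G by fact
  have IH: "fc_series G \<beta> \<lhd> G" "\<gamma> \<le> \<beta> \<Longrightarrow> fc_series G \<gamma> \<subseteq> fc_series G \<beta>" if "\<beta> < \<alpha>" for \<beta> \<gamma>
    using less.IH[OF that] by auto
  consider (zero) "\<forall>\<beta>. \<alpha> \<le> \<beta>"
    | (succ) \<kappa> where "\<not> (\<forall>\<beta>. \<alpha> \<le> \<beta>)" "\<kappa> < \<alpha>" "\<forall>\<gamma><\<alpha>. \<gamma> \<le> \<kappa>"
    | (lim) "\<not> (\<forall>\<beta>. \<alpha> \<le> \<beta>)" "\<not> (\<exists>\<beta><\<alpha>. \<forall>\<gamma><\<alpha>. \<gamma> \<le> \<beta>)"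
    by blast
  then show ?case
  proof cases
    case zero
    then have "fc_series G \<alpha> = {\<one>\<^bsub>G\<^esub>}"
      by (simp add: fc_series.simps)
    moreover have "\<beta> = \<alpha>" if "\<beta> \<le> \<alpha>" for \<beta>
      using zero that by (simp add: order_antisym)
    ultimately show ?thesis
      using one_is_normal by auto
  next
    case succ
    have "(GREATEST \<beta>. \<beta> < \<alpha>) = \<kappa>"
      using succ by (intro Greatest_equality) auto
    moreover have "\<exists>\<beta><\<alpha>. \<forall>\<gamma><\<alpha>. \<gamma> \<le> \<beta>"
      using succ by blast
    ultimately have eq: "fc_series G \<alpha> = fc_next G (fc_series G \<kappa>)"
      using succ(1) by (subst fc_series.simps) (simp only: if_True if_False)
    have "fc_series G \<beta> \<subseteq> fc_series G \<alpha>" if "\<beta> \<le> \<alpha>" for \<beta>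
    proof (cases "\<beta> = \<alpha>")
      case False
      then have "\<beta> \<le> \<kappa>"
        using that succ(3) by auto
      then show ?thesis
        using IH[OF succ(2)] normal_fc_next(2) eq by blast
    qed simp
    then show ?thesis
      using eq normal_fc_next(1) IH(1)[OF succ(2)] by simp
  next
    case lim
    then have eq: "fc_series G \<alpha> = (\<Union>\<beta>\<in>{..<\<alpha>}. fc_series G \<beta>)"
      by (subst fc_series.simps) (simp only: if_False)
    have ex: "\<exists>\<beta>. \<beta> < \<alpha>"
      using lim(1) by (auto simp: not_le)
    have sub: "subgroup (fc_series G \<beta>) G" if "\<beta> < \<alpha>" for \<beta>
      using IH(1)[OF that] by (simp add: normal_imp_subgroup)
    have "subgroup (fc_series G \<alpha>) G"
    proof (rule subgroupI)
      show "fc_series G \<alpha> \<subseteq> carrier G"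
        using sub subgroup.subset unfolding eq by blast
      show "fc_series G \<alpha> \<noteq> {}"
        using ex sub subgroup.one_closed unfolding eq by blast
    next
      fix a assume "a \<in> fc_series G \<alpha>"
      then obtain \<beta> where "\<beta> < \<alpha>" "a \<in> fc_series G \<beta>"
        unfolding eq by blast
      then show "inv\<^bsub>G\<^esub> a \<in> fc_series G \<alpha>"
        using subgroup.m_inv_closed[OF sub] unfolding eq by blast
    next
      fix a b assume "a \<in> fc_series G \<alpha>" "b \<in> fc_series G \<alpha>"
      then obtain \<beta> \<gamma> where bc: "\<beta> < \<alpha>" "\<gamma> < \<alpha>" "a \<in> fc_series G \<beta>" "b \<in> fc_series G \<gamma>"
        unfolding eq by blast
      define \<delta> where "\<delta> = max \<beta> \<gamma>"
      have "\<delta> < \<alpha>" "a \<in> fc_series G \<delta>" "b \<in> fc_series G \<delta>"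
        using bc IH(2)[of \<delta> \<beta>] IH(2)[of \<delta> \<gamma>] by (auto simp: \<delta>_def)
      then show "a \<otimes>\<^bsub>G\<^esub> b \<in> fc_series G \<alpha>"
        using subgroup.m_closed[OF sub] unfolding eq by blast
    qed
    moreover have "x \<otimes>\<^bsub>G\<^esub> h \<otimes>\<^bsub>G\<^esub> inv\<^bsub>G\<^esub> x \<in> fc_series G \<alpha>"
      if xh: "x \<in> carrier G" "h \<in> fc_series G \<alpha>" for x h
    proof -
      obtain \<beta> where "\<beta> < \<alpha>" "h \<in> fc_series G \<beta>"
        using xh unfolding eq by blast
      then show ?thesis
        using normal.inv_op_closed2[OF IH(1)] xh(1) unfolding eq by blast
    qed
    ultimately have "fc_series G \<alpha> \<lhd> G"
      unfolding normal_inv_iff by blast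
    moreover have "fc_series G \<beta> \<subseteq> fc_series G \<alpha>" if "\<beta> \<le> \<alpha>" for \<beta>
      using that unfolding order_le_less by (auto simp: eq)
    ultimately show ?thesis
      by blast
  qed
qed

lemmas normal_fc_series = normal_mono_fc_series[THEN conjunct1]

lemma fc_series_mono: "group G \<Longrightarrow> \<beta> \<le> \<alpha> \<Longrightarrow> fc_series G \<beta> \<subseteq> fc_series G \<alpha>"
  using normal_mono_fc_series by blast

lemma fc_series_stabilises:
  assumes "group G" "countable (carrier G)"
  shows "\<exists>\<alpha> :: countable_ordinal. \<forall>\<beta>\<ge>\<alpha>. fc_series G \<beta> = fc_series G \<alpha>"
proof -
  let ?Z = "fc_series G :: countable_ordinal \<Rightarrow> _"
  have sub: "?Z \<beta> \<subseteq> carrier G" for \<beta>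
    by (rule subgroup.subset[OF normal_imp_subgroup[OF normal_fc_series[OF assms(1)]]])
  define rank where "rank x = (LEAST \<beta>. x \<in> ?Z \<beta>)" for x
  have "countable (rank ` carrier G)"
    using assms(2) by simp
  moreover have "countable (\<Union>\<beta>\<in>rank ` carrier G. {..\<beta>})"
  proof (rule countable_UN[OF calculation])
    fix \<beta> :: countable_ordinal
    have "{..\<beta>} = insert \<beta> {..<\<beta>}"
      by auto
    then show "countable {..\<beta>}"
      using countable_below_countable_ordinal by simp
  qed
  ultimately obtain \<alpha> where \<alpha>: "\<alpha> \<notin> (\<Union>\<beta>\<in>rank ` carrier G. {..\<beta>})"
    using uncountable_countable_ordinal by (metis UNIV_eq_I)
  have "?Z \<beta> \<subseteq> ?Z \<alpha>" for \<beta>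
  proof
    fix x assume x: "x \<in> ?Z \<beta>"
    then have "x \<in> ?Z (rank x)"
      unfolding rank_def by (rule LeastI)
    moreover have "rank x \<le> \<alpha>"
      using \<alpha> x sub by force
    ultimately show "x \<in> ?Z \<alpha>"
      using fc_series_mono[OF assms(1)] by blast
  qed
  then show ?thesis
    using fc_series_mono[OF assms(1)] by (metis subset_antisym)
qed

definition fc_hypercentre :: "('a, 'b) monoid_scheme \<Rightarrow> 'a set" where
  "fc_hypercentre G = (THE H. \<exists>\<alpha> :: countable_ordinal. \<forall>\<beta>\<ge>\<alpha>. fc_series G \<beta> = H)"

lemma fc_hypercentre_eq:
  assumes "\<And>\<beta> :: countable_ordinal. \<beta> \<ge> \<alpha> \<Longrightarrow> fc_series G \<beta> = fc_series G \<alpha>"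
  shows "fc_hypercentre G = fc_series G \<alpha>"
  unfolding fc_hypercentre_def
proof (rule the_equality)
  fix H assume "\<exists>\<alpha> :: countable_ordinal. \<forall>\<beta>\<ge>\<alpha>. fc_series G \<beta> = H"
  then obtain \<gamma> :: countable_ordinal where "\<forall>\<beta>\<ge>\<gamma>. fc_series G \<beta> = H"
    by blast
  then show "H = fc_series G \<alpha>"
    using assms[of "max \<alpha> \<gamma>"] by (metis max.cobounded1 max.cobounded2)
qed (use assms in blast)


section \<open>Random walks and harmonic functions\<close>

text \<open>
  A probability measure on a countable group \<open>G\<close> is a pmf \<open>P\<close> with
  \<open>set_pmf P \<subseteq> carrier G\<close>.
\<close>

definition convolve_fun ::
  "('a, 'b) monoid_scheme \<Rightarrow> ('a \<Rightarrow> real) \<Rightarrow> 'a pmf \<Rightarrow> 'a \<Rightarrow> real" where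
  "convolve_fun G f P \<gamma> = (\<Sum>\<^sub>\<infinity>y\<in>carrier G. f (\<gamma> \<otimes>\<^bsub>G\<^esub> inv\<^bsub>G\<^esub> y) * pmf P y)"

definition harmonic :: "('a, 'b) monoid_scheme \<Rightarrow> 'a pmf \<Rightarrow> ('a \<Rightarrow> real) \<Rightarrow> bool" where
  "harmonic G P f \<longleftrightarrow> (\<forall>\<gamma>\<in>carrier G. convolve_fun G f P \<gamma> = f \<gamma>)"

definition liouville :: "('a, 'b) monoid_scheme \<Rightarrow> 'a pmf \<Rightarrow> bool" where
  "liouville G P \<longleftrightarrow>
     (\<forall>f. bounded (f ` carrier G) \<and> harmonic G P f \<longrightarrow> (\<exists>c. \<forall>\<gamma>\<in>carrier G. f \<gamma> = c))"

primrec convolution_power :: "('a, 'b) monoid_scheme \<Rightarrow> 'a pmf \<Rightarrow> nat \<Rightarrow> 'a pmf" where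
  "convolution_power G P 0 = return_pmf \<one>\<^bsub>G\<^esub>"
| "convolution_power G P (Suc n) =
     map_pmf (\<lambda>(x, y). x \<otimes>\<^bsub>G\<^esub> y) (pair_pmf (convolution_power G P n) P)"

definition symmetric_pmf :: "('a, 'b) monoid_scheme \<Rightarrow> 'a pmf \<Rightarrow> bool" where
  "symmetric_pmf G P \<longleftrightarrow> (\<forall>x\<in>carrier G. pmf P x = pmf P (inv\<^bsub>G\<^esub> x))"

text \<open>
  Measures of total mass at most 1 are given by their densities \<open>m\<close> with respect to counting
  measure on \<open>carrier G\<close>.
\<close>

definition density_support :: "'a set \<Rightarrow> ('a \<Rightarrow> real) \<Rightarrow> 'a set" where
  "density_support A m = {x \<in> A. m x \<noteq> 0}"

definition push_forward :: "'a set \<Rightarrow> ('a \<Rightarrow> 'c) \<Rightarrow> ('a \<Rightarrow> real) \<Rightarrow> 'c \<Rightarrow> real" where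
  "push_forward A \<phi> m y = (\<Sum>\<^sub>\<infinity>x\<in>{x \<in> A. \<phi> x = y}. m x)"

definition conjugation_invariant :: "('a, 'b) monoid_scheme \<Rightarrow> 'a set \<Rightarrow> bool" where
  "conjugation_invariant G S \<longleftrightarrow>
     (\<forall>g\<in>carrier G. \<forall>x\<in>S. g \<otimes>\<^bsub>G\<^esub> x \<otimes>\<^bsub>G\<^esub> inv\<^bsub>G\<^esub> g \<in> S)"

end

theory Submission
  imports Defs
begin

text \<open>
  Harmonic functions are those preserved in mean by the step \<open>\<gamma> \<mapsto> \<gamma> y\<inverse>\<close>, where \<open>y\<close> has law \<open>\<mu>\<close>.
  Everything rests on one claim: a bounded \<open>\<mu>\<close>-harmonic function \<open>f\<close> on \<open>\<Gamma>\<close> is invariant under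
  \<open>N\<close> (lemma \<open>fc_hypercentral_invariant\<close>). Then \<open>f\<close> descends to \<open>\<Gamma>/N\<close>, where the image of \<open>\<mu>\<close> is a
  lazy version of \<open>\<nu>\<close>: off the identity the two measures are proportional, so they have the same
  bounded harmonic functions (lemma \<open>harmonic_proportional_iff\<close>). Conversely, harmonic functions on
  \<open>\<Gamma>/N\<close> lift to \<open>\<Gamma>\<close>.

  Let \<open>T\<close> be the submonoid of points that the walk can reach from the identity. The support of \<open>\<mu>\<close>
  generates \<open>\<Gamma>\<close> as a group, but \<open>T\<close> may be much smaller than \<open>\<Gamma>\<close>. Two facts make up for this.

  The first is analytic (lemma \<open>fc_centre_invariant\<close>). Let \<open>x\<close> have a finite conjugacy class and
  suppose that \<open>\<sigma>\<close> and \<open>x \<sigma>\<close> both lie in \<open>T\<close>. Let \<open>g(\<gamma>) = f(\<gamma>) - f(x \<gamma>)\<close>, again harmonic, with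
  supremum \<open>M\<close>. If \<open>g(h)\<close> is close to \<open>M\<close>, the maximum principle makes \<open>g\<close> close to \<open>M\<close> at \<open>h \<tau>\<close> for
  any finite set of \<open>\<tau> \<in> T\<close> fixed in advance. Some power \<open>w\<close> of \<open>\<sigma>\<close> commutes with \<open>x\<close>, and then
  \<open>x\<^sup>k w\<^sup>n \<in> T\<close> for all \<open>k \<le> n\<close>. Since \<open>T\<close> permutes the finite conjugacy class of \<open>x\<close> as transitively
  as \<open>\<Gamma>\<close> does, one can first move inside \<open>T\<close> to a point that commutes with \<open>x\<close>. From there on the
  values of \<open>g\<close> at the points \<open>x\<^sup>k w\<^sup>n\<close> telescope, and their sum, about \<open>n M\<close>, is bounded by twice the
  bound of \<open>f\<close>. Hence \<open>M \<le> 0\<close>.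

  The second is algebraic (lemma \<open>generate_submonoid_is_quotient\<close>). A submonoid of the FC-hypercentre
  satisfies the Ore condition, so the group that it generates consists of quotients of its elements.
  Applied to \<open>T \<inter> N\<close>, which generates \<open>N\<close>, this provides for every \<open>x \<in> N\<close> an element \<open>\<sigma> \<in> T\<close> with
  \<open>x \<sigma> \<in> T\<close>.

  Transfinite induction along the FC-series combines the two: once \<open>f\<close> is invariant under
  \<open>N \<inter> Z\<close> with \<open>Z\<close> a term of the series, it descends to the quotient by \<open>N \<inter> Z\<close>, where the elements
  of \<open>N\<close> in the next term have finite conjugacy classes.
\<close>

section \<open>Submonoids and finite conjugacy classes\<close>

text \<open>
  Generators are appended on the right, so that induction follows the steps of a walk by right
  multiplication.
\<close>
inductive_set monoid_span :: "('a, 'b) monoid_scheme \<Rightarrow> 'a set \<Rightarrow> 'a set"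
  for G and S where
  one: "\<one>\<^bsub>G\<^esub> \<in> monoid_span G S"
| snoc: "\<tau> \<in> monoid_span G S \<Longrightarrow> s \<in> S \<Longrightarrow> \<tau> \<otimes>\<^bsub>G\<^esub> s \<in> monoid_span G S"

context group
begin

lemma submonoid_monoid_span:
  assumes "S \<subseteq> carrier G"
  shows "submonoid (monoid_span G S) G"
proof -
  have sub: "monoid_span G S \<subseteq> carrier G"
  proof
    fix \<tau> assume "\<tau> \<in> monoid_span G S"
    then show "\<tau> \<in> carrier G"
      by induction (use assms in auto)
  qed
  have "\<sigma> \<otimes> \<tau> \<in> monoid_span G S" if "\<tau> \<in> monoid_span G S" "\<sigma> \<in> monoid_span G S" for \<sigma> \<tau>
    using that(1)
  proof induction
    case one
    then show ?case using that(2) sub by auto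
  next
    case (snoc \<tau> s)
    then have "\<sigma> \<otimes> (\<tau> \<otimes> s) = (\<sigma> \<otimes> \<tau>) \<otimes> s"
      using that(2) sub assms by (auto simp: m_assoc subset_eq)
    then show ?case using snoc monoid_span.snoc by metis
  qed
  then show ?thesis
    by unfold_locales (use sub monoid_span.one in auto)
qed

lemma monoid_span_incl: "S \<subseteq> carrier G \<Longrightarrow> S \<subseteq> monoid_span G S"
proof
  fix s assume "S \<subseteq> carrier G" "s \<in> S"
  then show "s \<in> monoid_span G S"
    using monoid_span.snoc[OF monoid_span.one, of s S G] by (simp add: subset_eq)
qed

lemma submonoid_pow:
  assumes "submonoid T G" "x \<in> T"
  shows "x [^] (n::nat) \<in> T"
proof -
  interpret T: submonoid T G by fact
  show ?thesis using assms(2) by (induction n) simp_all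
qed

lemma generate_subset_if_inverses:
  assumes "S \<subseteq> carrier G" "generate G (m_inv G ` S) \<subseteq> H" "subgroup H G"
  shows "generate G S \<subseteq> H"
proof -
  have "S \<subseteq> H"
  proof
    fix x assume x: "x \<in> S"
    then have "inv x \<in> generate G (m_inv G ` S)"
      by (intro generate.incl imageI)
    then have "inv (inv x) \<in> H"
      using assms(2,3) subgroup.m_inv_closed by (metis subsetD)
    then show "x \<in> H"
      using x assms(1) inv_inv[of x] by auto
  qed
  then show ?thesis using assms(3) generate_subgroup_incl by blast
qed

lemma fc_centre_closed: "x \<in> fc_centre G \<Longrightarrow> x \<in> carrier G"
  by (simp add: fc_centre_def)

lemma fc_centre_conj:
  assumes "x \<in> fc_centre G" "g \<in> carrier G"
  shows "inv g \<otimes> x \<otimes> g \<in> fc_centre G"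
  using normal.inv_op_closed1[OF normal_fc_centre[OF group_axioms]] assms by blast

text \<open>
  Conjugation by \<open>y\<close> permutes the finite conjugacy class of \<open>x\<close>, so some power of it fixes \<open>x\<close>.
\<close>
lemma fc_centre_commutes_power:
  assumes x: "x \<in> fc_centre G" and y: "y \<in> carrier G"
  shows "\<exists>d>0. x \<otimes> y [^] (d::nat) = y [^] d \<otimes> x"
proof -
  note xc = fc_centre_closed[OF x]
  let ?c = "\<lambda>k::nat. y [^] k \<otimes> x \<otimes> inv (y [^] k)"
  have "range ?c \<subseteq> {g \<otimes> x \<otimes> inv g | g. g \<in> carrier G}"
    using y by blast
  then have "finite (range ?c)"
    using x finite_subset unfolding fc_centre_def by blast
  then have "\<not> inj ?c"
    using finite_imageD infinite_UNIV_nat by blast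
  then obtain i j where ij: "i < j" "?c i = ?c j"
    unfolding inj_def by (metis linorder_neqE_nat)
  have "y [^] j = y [^] i \<otimes> y [^] (j - i)"
    using ij(1) y by (simp add: nat_pow_mult)
  then have "y [^] i \<otimes> x \<otimes> inv (y [^] i) =
      y [^] i \<otimes> (y [^] (j - i) \<otimes> x \<otimes> inv (y [^] (j - i))) \<otimes> inv (y [^] i)"
    using ij(2) xc y by (simp add: inv_mult_group m_assoc)
  then have "x = y [^] (j - i) \<otimes> x \<otimes> inv (y [^] (j - i))"
    using xc y by simp
  then have "x \<otimes> y [^] (j - i) = y [^] (j - i) \<otimes> x"
    using xc y by (metis inv_solve_right m_closed nat_pow_closed)
  then show ?thesis using ij(1) by (intro exI[of _ "j - i"]) auto
qed

text \<open>
  On a finite set, the inverse of a permutation is one of its powers. Hence a submonoid that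
  generates the group has the same orbits on a finite conjugacy class as the group itself.
\<close>
lemma conjugate_by_generating_submonoid:
  assumes T: "submonoid T G" and gen: "generate G T = carrier G"
    and g: "g \<in> carrier G" and x: "x \<in> fc_centre G"
  shows "\<exists>\<tau>\<in>T. inv \<tau> \<otimes> x \<otimes> \<tau> = inv g \<otimes> x \<otimes> g"
proof -
  interpret T: submonoid T G by fact
  have "g \<in> generate G T" using g gen by simp
  then show ?thesis using x
  proof (induction arbitrary: x)
    case one
    then show ?case by (intro bexI[of _ \<one>]) auto
  next
    case (incl h)
    then show ?case by blast
  next
    case (inv h)
    then have h: "h \<in> carrier G" "x \<in> carrier G" using T.subset fc_centre_closed by auto
    obtain d :: nat where d: "d > 0" "x \<otimes> h [^] d = h [^] d \<otimes> x"
      using fc_centre_commutes_power[OF inv(2) h(1)] by blast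
    (* conjugation by h to the power d fixes x, so conjugation by h^(d-1) undoes conjugation by h *)
    let ?\<tau> = "h [^] (d - 1)"
    have hd: "h [^] d = ?\<tau> \<otimes> h" "h [^] d = h \<otimes> ?\<tau>"
      using d(1) h nat_pow_Suc2[of h "d - 1"] by (auto simp flip: nat_pow_Suc)
    have "x \<otimes> ?\<tau> \<otimes> h = ?\<tau> \<otimes> h \<otimes> x"
      using d(2) h unfolding hd(1) by (simp add: m_assoc)
    then have "x \<otimes> ?\<tau> = ?\<tau> \<otimes> (h \<otimes> x \<otimes> inv h)"
      using h by (metis inv_solve_right m_assoc m_closed nat_pow_closed inv_closed)
    then have "inv ?\<tau> \<otimes> x \<otimes> ?\<tau> = h \<otimes> x \<otimes> inv h"
      using h by (metis inv_solve_left inv_closed m_assoc m_closed nat_pow_closed)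
    then show ?case
      using submonoid_pow[OF T inv(1)] h by (intro bexI[of _ ?\<tau>]) auto
  next
    case (eng g h)
    then have gh: "g \<in> carrier G" "h \<in> carrier G" using gen by auto
    note xc = fc_centre_closed[OF eng.prems]
    let ?y = "inv g \<otimes> x \<otimes> g"
    obtain \<sigma> where s: "\<sigma> \<in> T" "inv \<sigma> \<otimes> x \<otimes> \<sigma> = ?y"
      using eng by blast
    obtain \<tau> where t: "\<tau> \<in> T" "inv \<tau> \<otimes> ?y \<otimes> \<tau> = inv h \<otimes> ?y \<otimes> h"
      using eng.IH(2)[OF fc_centre_conj[OF eng.prems gh(1)]] by blast
    have c: "\<sigma> \<in> carrier G" "\<tau> \<in> carrier G" using s t T.subset by auto
    have "inv (\<sigma> \<otimes> \<tau>) \<otimes> x \<otimes> (\<sigma> \<otimes> \<tau>) = inv \<tau> \<otimes> (inv \<sigma> \<otimes> x \<otimes> \<sigma>) \<otimes> \<tau>"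
      using c xc by (simp add: inv_mult_group m_assoc)
    also have "\<dots> = inv (g \<otimes> h) \<otimes> x \<otimes> (g \<otimes> h)"
      unfolding s t using gh xc by (simp add: inv_mult_group m_assoc)
    finally show ?case using s t by blast
  qed
qed

end

section \<open>The FC-series and quotients\<close>

text \<open>
  Membership in the next term of the FC-series, in terms of cosets of conjugates taken in \<open>G\<close>.
\<close>
lemma (in normal) fc_next_iff:
  "x \<in> fc_next G H \<longleftrightarrow>
     x \<in> carrier G \<and> finite ((\<lambda>g. H #> (g \<otimes> x \<otimes> inv g)) ` carrier G)"
proof (cases "x \<in> carrier G")
  case x: True
  interpret \<phi>: group_hom G "G Mod H" "\<lambda>x. H #> x"
    by (intro group_hom.intro group_hom_axioms.intro factorgroup_is_group r_coset_hom_Mod is_group)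
  have conj: "(H #> g) \<otimes>\<^bsub>G Mod H\<^esub> (H #> x) \<otimes>\<^bsub>G Mod H\<^esub> inv\<^bsub>G Mod H\<^esub> (H #> g) = H #> (g \<otimes> x \<otimes> inv g)"
    if "g \<in> carrier G" for g
    using that x \<phi>.hom_mult \<phi>.hom_inv inv_closed m_closed by metis
  have "carrier (G Mod H) = (\<lambda>g. H #> g) ` carrier G"
    by (auto simp: carrier_FactGroup)
  then have "{g \<otimes>\<^bsub>G Mod H\<^esub> (H #> x) \<otimes>\<^bsub>G Mod H\<^esub> inv\<^bsub>G Mod H\<^esub> g | g. g \<in> carrier (G Mod H)} =
      (\<lambda>g. H #> (g \<otimes> x \<otimes> inv g)) ` carrier G"
    using conj by (auto simp: image_iff) metis+
  then show ?thesis
    using x \<phi>.hom_closed[OF x] by (simp add: fc_next_def fc_centre_def)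
qed (simp add: fc_next_def)

text \<open>
  The conjugates of \<open>x\<close> stay in the normal subgroup \<open>N\<close>, and elements of \<open>N\<close> that agree modulo \<open>H\<close>
  agree modulo \<open>N \<inter> H\<close>. So finitely many classes modulo \<open>H\<close> give finitely many modulo \<open>N \<inter> H\<close>.
\<close>
lemma (in group) fc_next_Int:
  assumes N: "N \<lhd> G" and H: "H \<lhd> G" and x: "x \<in> N" "x \<in> fc_next G H"
  shows "x \<in> fc_next G (N \<inter> H)"
proof -
  interpret N: normal N G by fact
  interpret H: normal H G by fact
  interpret I: normal "N \<inter> H" G by (rule normal_subgroup_intersect[OF N H])
  define C where "C = (\<lambda>g. g \<otimes> x \<otimes> inv g) ` carrier G"
  have CN: "C \<subseteq> N"
    using x(1) N.inv_op_closed2 by (auto simp: C_def)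
  have eq: "(N \<inter> H) #> u = (N \<inter> H) #> v" if "u \<in> C" "v \<in> C" "H #> u = H #> v" for u v
  proof -
    have uv: "u \<in> N" "v \<in> N" "u \<in> carrier G" "v \<in> carrier G"
      using that CN N.subset by auto
    have "u \<otimes> inv v \<in> H"
      using coset_join1[OF coset_mult_inv2[OF that(3)]] uv H.subset H.is_subgroup by simp
    then have "u \<otimes> inv v \<in> N \<inter> H"
      using uv by simp
    then have "(N \<inter> H) #> (u \<otimes> inv v) = N \<inter> H"
      using I.rcos_const by simp
    then show ?thesis
      using coset_mult_inv1 uv I.subset by blast
  qed
  have "finite ((\<lambda>u. H #> u) ` C)"
    using x(2) unfolding H.fc_next_iff C_def by (simp add: image_image)
  moreover have "(\<lambda>u. (N \<inter> H) #> u) ` C \<subseteq>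
      (\<lambda>D. (N \<inter> H) #> inv_into C (\<lambda>u. H #> u) D) ` (\<lambda>u. H #> u) ` C"
  proof (rule image_subsetI)
    fix u assume u: "u \<in> C"
    have "(N \<inter> H) #> u = (N \<inter> H) #> inv_into C (\<lambda>u. H #> u) (H #> u)"
      using u by (intro eq inv_into_into f_inv_into_f[symmetric]) auto
    then show "(N \<inter> H) #> u \<in> (\<lambda>D. (N \<inter> H) #> inv_into C (\<lambda>u. H #> u) D) ` (\<lambda>u. H #> u) ` C"
      using u by blast
  qed
  ultimately have "finite ((\<lambda>u. (N \<inter> H) #> u) ` C)"
    by (rule finite_surj)
  then show ?thesis
    using x(1) N.subset unfolding I.fc_next_iff C_def by (auto simp: image_image)
qed

text \<open>
  The commutation lemma for finite conjugacy classes, applied in the quotient by \<open>H\<close>: the commutator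
  of \<open>x\<close> with some power of \<open>y\<close> falls into \<open>H\<close>.
\<close>
lemma (in normal) fc_next_commutes_power:
  assumes x: "x \<in> fc_next G H" and y: "y \<in> carrier G"
  shows "\<exists>d>0. inv x \<otimes> inv (y [^] (d::nat)) \<otimes> x \<otimes> y [^] d \<in> H"
proof -
  interpret Q: group "G Mod H" by (rule factorgroup_is_group)
  interpret \<phi>: group_hom G "G Mod H" "\<lambda>x. H #> x"
    by unfold_locales (rule r_coset_hom_Mod)
  have xc: "x \<in> carrier G" and xq: "H #> x \<in> fc_centre (G Mod H)"
    using x by (auto simp: fc_next_def)
  obtain d :: nat where d: "d > 0"
    "(H #> x) \<otimes>\<^bsub>G Mod H\<^esub> (H #> y) [^]\<^bsub>G Mod H\<^esub> d = (H #> y) [^]\<^bsub>G Mod H\<^esub> d \<otimes>\<^bsub>G Mod H\<^esub> (H #> x)"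
    using Q.fc_centre_commutes_power[OF xq \<phi>.hom_closed[OF y]] by auto
  have "(H #> y) [^]\<^bsub>G Mod H\<^esub> d = H #> y [^] d"
    using \<phi>.hom_nat_pow[OF y] by metis
  then have eq: "H #> (x \<otimes> y [^] d) = H #> (y [^] d \<otimes> x)"
    using d(2) \<phi>.hom_mult[OF xc nat_pow_closed[OF y, of d]]
      \<phi>.hom_mult[OF nat_pow_closed[OF y, of d] xc] by metis
  have "H #> (inv (y [^] d \<otimes> x) \<otimes> (x \<otimes> y [^] d)) =
      inv\<^bsub>G Mod H\<^esub> (H #> (y [^] d \<otimes> x)) \<otimes>\<^bsub>G Mod H\<^esub> (H #> (x \<otimes> y [^] d))"
    using xc y by (metis \<phi>.hom_mult \<phi>.hom_inv inv_closed m_closed nat_pow_closed)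
  also have "\<dots> = H"
    using Q.l_inv[OF \<phi>.hom_closed[of "y [^] d \<otimes> x"]] xc y unfolding eq
    by (simp only: m_closed nat_pow_closed one_FactGroup)
  finally have "inv (y [^] d \<otimes> x) \<otimes> (x \<otimes> y [^] d) \<in> H"
    by (rule coset_join1) (use xc y is_subgroup in auto)
  then show ?thesis
    using d(1) xc y by (intro exI[of _ d]) (simp add: inv_mult_group m_assoc)
qed

section \<open>The Ore condition in the FC-hypercentre\<close>

lemma ordinal_cases [case_names zero successor limit]:
  fixes \<alpha> :: "'o::{wellorder, no_top}"
  obtains "\<And>\<beta>. \<alpha> \<le> \<beta>"
    | \<beta> where "\<beta> < \<alpha>" "\<alpha> = osuc \<beta>"
    | "\<exists>\<beta>. \<beta> < \<alpha>" "\<And>\<beta>. \<beta> < \<alpha> \<Longrightarrow> osuc \<beta> < \<alpha>"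
proof -
  consider "\<forall>\<beta>. \<alpha> \<le> \<beta>" | \<beta> where "\<beta> < \<alpha>" "\<alpha> \<le> osuc \<beta>"
    | "\<exists>\<beta>. \<beta> < \<alpha>" "\<forall>\<beta><\<alpha>. osuc \<beta> < \<alpha>"
    by (meson not_le)
  then show ?thesis
  proof cases
    case 1
    show ?thesis by (rule that(1)) (use 1 in simp)
  next
    case (2 \<beta>)
    then have "\<alpha> = osuc \<beta>"
      by (meson less_osuc_iff not_le order_antisym)
    with 2(1) show ?thesis by (rule that(2))
  next
    case 3
    show ?thesis by (rule that(3)) (use 3 in simp_all)
  qed
qed

text \<open>
  Descent along the FC-series. Write \<open>u = v z\<close> with \<open>z\<close> in the term after \<open>Z\<close>. Some power \<open>w = v\<^sup>d\<close>
  commutes with \<open>z\<close> modulo \<open>Z\<close>, hence \<open>u w = v z w\<close> and \<open>w u = v w z\<close> agree modulo \<open>Z\<close>. Both lie in \<open>T\<close>,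
  so the induction hypothesis provides a common right multiple of them. As \<open>d > 0\<close>, it is a right
  multiple of \<open>u\<close> and of \<open>v\<close>.
\<close>
lemma (in group) common_right_multiple_mod_fc_series:
  fixes \<alpha> :: "'o::{wellorder, no_top}"
  assumes T: "submonoid T G"
    and "u \<in> T" "v \<in> T" "inv v \<otimes> u \<in> fc_series G \<alpha>"
  shows "\<exists>p\<in>T. \<exists>q\<in>T. u \<otimes> p = v \<otimes> q"
  using assms(2-)
proof (induction \<alpha> arbitrary: u v rule: less_induct)
  case (less \<alpha>)
  interpret T: submonoid T G by fact
  have c: "u \<in> carrier G" "v \<in> carrier G"
    using less.prems T.subset by auto
  show ?case
  proof (cases \<alpha> rule: ordinal_cases)
    case zero
    then have "inv v \<otimes> u = \<one>"
      using less.prems(3) by (simp add: fc_series_zero)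
    then have "u = v"
      using c inv_solve_left'[of \<one> v u] by simp
    then show ?thesis using T.one_closed by blast
  next
    case (successor \<beta>)
    interpret Z: normal "fc_series G \<beta>" G
      by (rule normal_fc_series) (rule group_axioms)
    define z where "z = inv v \<otimes> u"
    have z: "z \<in> fc_next G (fc_series G \<beta>)" "z \<in> carrier G" and u: "u = v \<otimes> z"
      using less.prems(3) c inv_solve_left[of z v u]
      by (simp_all add: successor(2) fc_series_osuc z_def)
    obtain d :: nat where "d > 0" and d: "inv z \<otimes> inv (v [^] d) \<otimes> z \<otimes> v [^] d \<in> fc_series G \<beta>"
      using Z.fc_next_commutes_power[OF z(1) c(2)] by blast
    let ?w = "v [^] d"
    have w: "?w \<in> T" "?w \<in> carrier G" using submonoid_pow[OF T] less.prems c by auto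
    have vw: "inv v \<otimes> (inv ?w \<otimes> (v \<otimes> h)) = inv ?w \<otimes> h" if "h \<in> carrier G" for h
    proof -
      have "v \<otimes> ?w = ?w \<otimes> v"
        using c by (simp flip: nat_pow_Suc2)
      then have "inv v \<otimes> inv ?w = inv ?w \<otimes> inv v"
        using c w by (simp flip: inv_mult_group)
      then have "inv v \<otimes> inv ?w \<otimes> (v \<otimes> h) = inv ?w \<otimes> (inv v \<otimes> (v \<otimes> h))"
        using c w that by (simp add: m_assoc)
      moreover have "inv v \<otimes> (v \<otimes> h) = h"
        using c that by (simp flip: m_assoc)
      ultimately show ?thesis
        using c w that by (simp add: m_assoc)
    qed
    have "inv (?w \<otimes> u) \<otimes> (u \<otimes> ?w) = inv z \<otimes> inv ?w \<otimes> z \<otimes> ?w"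
      using c w z(2) vw unfolding u by (simp add: inv_mult_group m_assoc)
    then obtain p q where pq: "p \<in> T" "q \<in> T" "u \<otimes> ?w \<otimes> p = ?w \<otimes> u \<otimes> q"
      using less.IH[OF successor(1), of "u \<otimes> ?w" "?w \<otimes> u"] less.prems w d by auto
    obtain e where e: "d = Suc e" using \<open>d > 0\<close> gr0_implies_Suc by blast
    have ve: "v [^] e \<in> T" "v [^] e \<in> carrier G" using submonoid_pow[OF T] less.prems c by auto
    have "?w = v \<otimes> v [^] e" using c by (simp only: e nat_pow_Suc2)
    then have "u \<otimes> (?w \<otimes> p) = v \<otimes> (v [^] e \<otimes> u \<otimes> q)"
      using pq(3) subsetD[OF T.subset pq(1)] subsetD[OF T.subset pq(2)] c w(2) ve(2)
      by (simp add: m_assoc)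
    moreover have "?w \<otimes> p \<in> T" "v [^] e \<otimes> u \<otimes> q \<in> T"
      using pq w(1) ve(1) less.prems(1) by simp_all
    ultimately show ?thesis by blast
  next
    case limit
    then obtain \<beta> where "\<beta> < \<alpha>" "inv v \<otimes> u \<in> fc_series G \<beta>"
      using less.prems(3) fc_series_limit[of \<alpha> G] by auto
    then show ?thesis using less.IH less.prems by blast
  qed
qed

text \<open>
  The classical consequence of the Ore condition: in \<open>\<tau>\<^sub>1 \<sigma>\<^sub>1\<inverse> \<tau>\<^sub>2 \<sigma>\<^sub>2\<inverse>\<close>, a common right multiple
  of \<open>\<sigma>\<^sub>1\<close> and \<open>\<tau>\<^sub>2\<close> allows the inner quotient \<open>\<sigma>\<^sub>1\<inverse> \<tau>\<^sub>2\<close> to be rewritten as an element of \<open>T\<close> times the inverse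
  of another.
\<close>
lemma (in group) generate_submonoid_is_quotient:
  fixes \<alpha> :: "'o::{wellorder, no_top}"
  assumes T: "submonoid T G" and "T \<subseteq> fc_series G \<alpha>"
    and "x \<in> generate G T"
  shows "\<exists>\<sigma>\<in>T. x \<otimes> \<sigma> \<in> T"
  using assms(3)
proof induction
  interpret T: submonoid T G by fact
  note Tc = subsetD[OF T.subset]
  {
    case one
    show ?case by (rule bexI[of _ \<one>]) simp_all
  next
    case (incl h)
    then show ?case using T.one_closed Tc by (intro bexI[of _ \<one>]) auto
  next
    case (inv h)
    then show ?case using T.one_closed Tc by (intro bexI[of _ h]) auto
  next
    case (eng x y)
    then obtain \<sigma> \<sigma>' where *: "\<sigma> \<in> T" "x \<otimes> \<sigma> \<in> T" "\<sigma>' \<in> T" "y \<otimes> \<sigma>' \<in> T"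
      by blast
    have xy: "x \<in> carrier G" "y \<in> carrier G"
      using eng.hyps generate_in_carrier[OF T.subset] by auto
    have "inv \<sigma> \<otimes> (y \<otimes> \<sigma>') \<in> fc_series G \<alpha>"
    proof -
      interpret Z: normal "fc_series G \<alpha>" G
        by (rule normal_fc_series) (rule group_axioms)
      show ?thesis
        using * assms(2) by (intro Z.m_closed[OF Z.m_inv_closed]) auto
    qed
    then obtain p q where pq: "p \<in> T" "q \<in> T" "y \<otimes> \<sigma>' \<otimes> p = \<sigma> \<otimes> q"
      using common_right_multiple_mod_fc_series[OF T *(4) *(1)] by blast
    have "x \<otimes> y \<otimes> (\<sigma>' \<otimes> p) = x \<otimes> (y \<otimes> \<sigma>' \<otimes> p)"
      using xy Tc[OF *(3)] Tc[OF pq(1)] by (simp add: m_assoc)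
    also have "\<dots> = x \<otimes> \<sigma> \<otimes> q"
      unfolding pq(3) using xy(1) Tc[OF *(1)] Tc[OF pq(2)] by (simp add: m_assoc)
    finally have "x \<otimes> y \<otimes> (\<sigma>' \<otimes> p) \<in> T"
      using T.m_closed[OF *(2) pq(2)] by simp
    then show ?case
      using T.m_closed[OF *(3) pq(1)] by blast
  }
qed

section \<open>Random walks and bounded harmonic functions\<close>

lemma (in group) harmonic_cong:
  assumes "\<And>\<gamma>. \<gamma> \<in> carrier G \<Longrightarrow> f \<gamma> = g \<gamma>"
  shows "harmonic G P f \<longleftrightarrow> harmonic G P g"
proof -
  have "convolve_fun G f P \<gamma> = convolve_fun G g P \<gamma>" if "\<gamma> \<in> carrier G" for \<gamma>
    unfolding convolve_fun_def using assms that by (intro infsum_cong) simp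
  then show ?thesis
    unfolding harmonic_def using assms by simp
qed

locale random_walk = group +
  fixes P :: "'a pmf"
  assumes supp: "set_pmf P \<subseteq> carrier G"
begin

text \<open>
  The increments of the walk are inverses of elements of the support, in accordance with the
  convolution \<open>f(\<gamma> y\<inverse>)\<close>.
\<close>
definition reach :: "'a set" where
  "reach = monoid_span G (m_inv G ` set_pmf P)"

lemma submonoid_reach: "submonoid reach G"
  unfolding reach_def using supp by (intro submonoid_monoid_span) auto

lemma reach_closed: "\<tau> \<in> reach \<Longrightarrow> \<tau> \<in> carrier G"
  using submonoid.subset[OF submonoid_reach] by blast

lemma inv_supp_reach: "s \<in> set_pmf P \<Longrightarrow> inv s \<in> reach"
  unfolding reach_def using supp by (intro subsetD[OF monoid_span_incl]) auto

lemma generate_supp_subset_generate_reach: "generate G (set_pmf P) \<subseteq> generate G reach"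
proof (rule generate_subset_if_inverses[OF supp])
  show "generate G (m_inv G ` set_pmf P) \<subseteq> generate G reach"
    using inv_supp_reach by (intro mono_generate) auto
  show "subgroup (generate G reach) G"
    using reach_closed by (intro generate_is_subgroup) auto
qed

lemma bounded_abs_bound:
  assumes "bounded (f ` carrier G)"
  obtains B where "\<And>\<gamma>. \<gamma> \<in> carrier G \<Longrightarrow> \<bar>f \<gamma> :: real\<bar> \<le> B"
  using assms unfolding bounded_iff by auto

lemma integrable_step:
  assumes "bounded (f ` carrier G)" "\<gamma> \<in> carrier G"
  shows "integrable (measure_pmf P) (\<lambda>y. f (\<gamma> \<otimes> inv y) :: real)"
proof -
  obtain B where "\<And>\<gamma>. \<gamma> \<in> carrier G \<Longrightarrow> \<bar>f \<gamma>\<bar> \<le> B"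
    using bounded_abs_bound[OF assms(1)] by blast
  then show ?thesis
    using supp assms(2)
    by (intro measure_pmf.integrable_const_bound[where B = B]) (auto intro!: AE_pmfI)
qed

lemma convolve_fun_eq_expectation:
  assumes f: "bounded (f ` carrier G)" and \<gamma>: "\<gamma> \<in> carrier G"
  shows "convolve_fun G f P \<gamma> = measure_pmf.expectation P (\<lambda>y. f (\<gamma> \<otimes> inv y))"
proof -
  let ?h = "\<lambda>y. pmf P y * f (\<gamma> \<otimes> inv y)"
  have "integrable (density (count_space UNIV) (\<lambda>y. ennreal (pmf P y))) (\<lambda>y. f (\<gamma> \<otimes> inv y))"
    using integrable_step[OF assms] unfolding measure_pmf_eq_density .
  then have "integrable (count_space UNIV) ?h"
    by (subst (asm) integrable_density) auto
  then have "Infinite_Set_Sum.abs_summable_on ?h UNIV"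
    by (simp add: Infinite_Set_Sum.abs_summable_on_def)
  then have "measure_pmf.expectation P (\<lambda>y. f (\<gamma> \<otimes> inv y)) = infsum ?h UNIV"
    using infsetsum_infsum pmf_expectation_eq_infsetsum by metis
  also have "\<dots> = convolve_fun G f P \<gamma>"
    unfolding convolve_fun_def using supp
    by (intro infsum_cong_neutral) (auto simp: set_pmf_iff)
  finally show ?thesis ..
qed

lemma harmonic_iff:
  assumes "bounded (f ` carrier G)"
  shows "harmonic G P f \<longleftrightarrow>
    (\<forall>\<gamma>\<in>carrier G. measure_pmf.expectation P (\<lambda>y. f (\<gamma> \<otimes> inv y)) = f \<gamma>)"
  unfolding harmonic_def using convolve_fun_eq_expectation[OF assms] by auto

lemma harmonic_minus:
  assumes "bounded (f ` carrier G)" "harmonic G P f"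
  shows "bounded ((\<lambda>\<gamma>. - f \<gamma>) ` carrier G)" "harmonic G P (\<lambda>\<gamma>. - f \<gamma>)"
proof -
  show "bounded ((\<lambda>\<gamma>. - f \<gamma>) ` carrier G)"
    using assms(1) by (simp add: bounded_iff)
  then show "harmonic G P (\<lambda>\<gamma>. - f \<gamma>)"
    using assms by (simp add: harmonic_iff)
qed

text \<open>
  The walk multiplies on the right, so left translates of harmonic functions are harmonic.
\<close>
lemma harmonic_left_difference:
  assumes f: "bounded (f ` carrier G)" "harmonic G P f" and x: "x \<in> carrier G"
  shows "bounded ((\<lambda>\<gamma>. f \<gamma> - f (x \<otimes> \<gamma>)) ` carrier G)"
    and "harmonic G P (\<lambda>\<gamma>. f \<gamma> - f (x \<otimes> \<gamma>))"
proof -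
  obtain B where B: "\<And>\<gamma>. \<gamma> \<in> carrier G \<Longrightarrow> \<bar>f \<gamma>\<bar> \<le> B"
    using bounded_abs_bound[OF f(1)] by blast
  have "\<bar>f \<gamma> - f (x \<otimes> \<gamma>)\<bar> \<le> B + B" if "\<gamma> \<in> carrier G" for \<gamma>
    using B[of \<gamma>] B[of "x \<otimes> \<gamma>"] x that abs_triangle_ineq4[of "f \<gamma>" "f (x \<otimes> \<gamma>)"] by simp
  then show bdd: "bounded ((\<lambda>\<gamma>. f \<gamma> - f (x \<otimes> \<gamma>)) ` carrier G)"
    unfolding bounded_iff by auto
  show "harmonic G P (\<lambda>\<gamma>. f \<gamma> - f (x \<otimes> \<gamma>))"
    unfolding harmonic_iff[OF bdd]
  proof
    fix \<gamma> assume \<gamma>: "\<gamma> \<in> carrier G"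
    have "measure_pmf.expectation P (\<lambda>y. f (\<gamma> \<otimes> inv y) - f (x \<otimes> (\<gamma> \<otimes> inv y))) =
        measure_pmf.expectation P (\<lambda>y. f (\<gamma> \<otimes> inv y) - f (x \<otimes> \<gamma> \<otimes> inv y))"
      using supp x \<gamma> by (intro integral_cong_AE) (auto intro!: AE_pmfI simp: m_assoc subset_eq)
    also have "\<dots> = measure_pmf.expectation P (\<lambda>y. f (\<gamma> \<otimes> inv y)) -
        measure_pmf.expectation P (\<lambda>y. f (x \<otimes> \<gamma> \<otimes> inv y))"
      using x \<gamma> by (intro Bochner_Integration.integral_diff integrable_step[OF f(1)]) auto
    also have "\<dots> = f \<gamma> - f (x \<otimes> \<gamma>)"
      using f(2) x \<gamma> unfolding harmonic_iff[OF f(1)] by simp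
    finally show "measure_pmf.expectation P (\<lambda>y. f (\<gamma> \<otimes> inv y) - f (x \<otimes> (\<gamma> \<otimes> inv y))) =
        f \<gamma> - f (x \<otimes> \<gamma>)" .
  qed
qed

section \<open>The maximum principle\<close>

text \<open>
  The defect \<open>M - g\<close> is nonnegative and harmonic, so its value at \<open>h\<close> is at least the contribution of
  the single step \<open>s\<close> to its mean.
\<close>
lemma near_max_step:
  assumes g: "bounded (g ` carrier G)" "harmonic G P g"
    and M: "\<And>\<gamma>. \<gamma> \<in> carrier G \<Longrightarrow> g \<gamma> \<le> M"
    and s: "s \<in> set_pmf P" and h: "h \<in> carrier G"
  shows "pmf P s * (M - g (h \<otimes> inv s)) \<le> M - g h"
proof -
  let ?c = "M - g (h \<otimes> inv s)"
  have "pmf P s * ?c = measure_pmf.expectation P (\<lambda>y. indicator {s} y * ?c)"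
    by (simp add: measure_pmf_single)
  also have "\<dots> \<le> measure_pmf.expectation P (\<lambda>y. M - g (h \<otimes> inv y))"
  proof (rule integral_mono_AE)
    show "integrable (measure_pmf P) (\<lambda>y. indicator {s} y * ?c)"
      by (intro measure_pmf.integrable_const_bound[where B = "\<bar>?c\<bar>"])
        (auto intro!: AE_pmfI simp: indicator_def)
    show "integrable (measure_pmf P) (\<lambda>y. M - g (h \<otimes> inv y))"
      using integrable_step[OF g(1) h] by simp
    show "AE y in measure_pmf P. indicator {s} y * ?c \<le> M - g (h \<otimes> inv y)"
      using supp h M by (intro AE_pmfI) (auto simp: indicator_def)
  qed
  also have "\<dots> = M - measure_pmf.expectation P (\<lambda>y. g (h \<otimes> inv y))"
    using integrable_step[OF g(1) h] by simp
  also have "\<dots> = M - g h"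
    using g h by (simp add: harmonic_iff)
  finally show ?thesis .
qed

text \<open>
  A harmonic function that attains its maximum keeps it along the walk. The quantitative form, uniform
  in the starting point, also covers starting points where \<open>g\<close> is only almost maximal.
\<close>
lemma near_max_reach:
  assumes g: "bounded (g ` carrier G)" "harmonic G P g"
    and M: "\<And>\<gamma>. \<gamma> \<in> carrier G \<Longrightarrow> g \<gamma> \<le> M"
    and \<tau>: "\<tau> \<in> reach" and "\<eta> > 0"
  shows "\<exists>\<epsilon>>0. \<forall>h\<in>carrier G. M - g h < \<epsilon> \<longrightarrow> M - g (h \<otimes> \<tau>) < \<eta>"
  using \<tau> \<open>\<eta> > 0\<close> unfolding reach_def
proof (induction arbitrary: \<eta>)
  case one
  then show ?case by auto
next
  case (snoc \<tau> s)
  then obtain r where r: "r \<in> set_pmf P" and s: "s = inv r" by blast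
  have p: "pmf P r > 0" using r by (rule pmf_positive)
  obtain \<epsilon> where \<epsilon>: "\<epsilon> > 0" "\<And>h. h \<in> carrier G \<Longrightarrow> M - g h < \<epsilon> \<Longrightarrow> M - g (h \<otimes> \<tau>) < pmf P r * \<eta>"
    using snoc.IH[of "pmf P r * \<eta>"] p snoc.prems by auto
  have \<tau>c: "\<tau> \<in> carrier G" using snoc.hyps reach_closed unfolding reach_def by blast
  have "M - g (h \<otimes> (\<tau> \<otimes> s)) < \<eta>" if h: "h \<in> carrier G" "M - g h < \<epsilon>" for h
  proof -
    have "pmf P r * (M - g (h \<otimes> \<tau> \<otimes> inv r)) < pmf P r * \<eta>"
      using near_max_step[OF g M r, of "h \<otimes> \<tau>"] \<epsilon>(2)[OF h] h \<tau>c by simp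
    moreover have "h \<otimes> \<tau> \<otimes> inv r = h \<otimes> (\<tau> \<otimes> s)"
      using h \<tau>c r supp by (auto simp: s m_assoc)
    ultimately show ?thesis using p by simp
  qed
  then show ?case using \<epsilon>(1) by blast
qed

lemma near_max_reach_finite:
  assumes g: "bounded (g ` carrier G)" "harmonic G P g"
    and M: "\<And>\<gamma>. \<gamma> \<in> carrier G \<Longrightarrow> g \<gamma> \<le> M"
    and F: "finite F" "F \<subseteq> reach" and \<eta>: "\<eta> > 0"
  shows "\<exists>\<epsilon>>0. \<forall>h\<in>carrier G. M - g h < \<epsilon> \<longrightarrow> (\<forall>\<tau>\<in>F. M - g (h \<otimes> \<tau>) < \<eta>)"
  using F
proof (induction F)
  case empty
  show ?case by (intro exI[of _ 1]) auto
next
  case (insert \<tau> F)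
  then obtain \<epsilon> where \<epsilon>: "\<epsilon> > 0"
    "\<And>h. h \<in> carrier G \<Longrightarrow> M - g h < \<epsilon> \<Longrightarrow> \<forall>\<tau>\<in>F. M - g (h \<otimes> \<tau>) < \<eta>"
    by auto
  obtain \<epsilon>' where \<epsilon>': "\<epsilon>' > 0" "\<And>h. h \<in> carrier G \<Longrightarrow> M - g h < \<epsilon>' \<Longrightarrow> M - g (h \<otimes> \<tau>) < \<eta>"
    using near_max_reach[OF g M _ \<eta>, of \<tau>] insert.prems by auto
  show ?case
    using \<epsilon> \<epsilon>' by (intro exI[of _ "min \<epsilon> \<epsilon>'"]) auto
qed

section \<open>Invariance under elements of the FC-centre\<close>

text \<open>
  Suppose that \<open>g(\<gamma>) = f(\<gamma>) - f(x \<gamma>)\<close> has supremum \<open>M > 0\<close>. Starting at a point \<open>h\<close> where \<open>g\<close> is almost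
  maximal, the walk reaches points of the form \<open>h \<tau> x\<^sup>k w\<^sup>n\<close> for which \<open>x\<close> commutes with \<open>h \<tau>\<close>. There
  \<open>g\<close> is a difference of consecutive values of \<open>f\<close> along \<open>k\<close>, each at least \<open>M / 2\<close>. For large \<open>n\<close> the sum
  over \<open>k < n\<close> exceeds the oscillation of \<open>f\<close>.
\<close>
lemma fc_centre_nondecreasing:
  assumes gen: "generate G (set_pmf P) = carrier G"
    and f: "bounded (f ` carrier G)" "harmonic G P f"
    and x: "x \<in> fc_centre G" and \<sigma>: "\<sigma> \<in> reach" "x \<otimes> \<sigma> \<in> reach"
    and \<gamma>: "\<gamma> \<in> carrier G"
  shows "f \<gamma> \<le> f (x \<otimes> \<gamma>)"
proof (rule ccontr)
  assume neg: "\<not> f \<gamma> \<le> f (x \<otimes> \<gamma>)"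
  interpret T: submonoid reach G by (rule submonoid_reach)
  note xc = fc_centre_closed[OF x] and \<sigma>c = reach_closed[OF \<sigma>(1)]
  let ?g = "\<lambda>\<gamma>. f \<gamma> - f (x \<otimes> \<gamma>)"
  have g: "bounded (?g ` carrier G)" "harmonic G P ?g"
    using harmonic_left_difference[OF f xc] by auto
  define M where "M = (SUP \<gamma>\<in>carrier G. ?g \<gamma>)"
  have bdd: "bdd_above (?g ` carrier G)"
    using g(1) by (rule bounded_imp_bdd_above)
  have M: "?g \<gamma> \<le> M" if "\<gamma> \<in> carrier G" for \<gamma>
    unfolding M_def using bdd that by (rule cSUP_upper2) simp
  have "M > 0" using M[OF \<gamma>] neg by linarith
  obtain B where B: "\<And>\<gamma>. \<gamma> \<in> carrier G \<Longrightarrow> \<bar>f \<gamma>\<bar> \<le> B"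
    using bounded_abs_bound[OF f(1)] by blast
  obtain n :: nat where n: "real n * (M / 2) > 2 * B"
    using reals_Archimedean3[of "M / 2"] \<open>M > 0\<close> half_gt_zero by meson
  obtain d :: nat where d: "d > 0" "x \<otimes> \<sigma> [^] d = \<sigma> [^] d \<otimes> x"
    using fc_centre_commutes_power[OF x \<sigma>c] by blast
  (* w commutes with x, and both w and x w are reachable; so is every product of them *)
  define w where "w = \<sigma> [^] d"
  have w: "w \<in> reach" "w \<in> carrier G" "x \<otimes> w = w \<otimes> x"
    using submonoid_pow[OF submonoid_reach \<sigma>(1)] \<sigma>c d(2) by (auto simp: w_def)
  have xw: "x \<otimes> w \<in> reach"
  proof -
    obtain e where e: "d = Suc e" using d(1) gr0_implies_Suc by blast
    have "x \<otimes> w = (x \<otimes> \<sigma>) \<otimes> \<sigma> [^] e"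
      using xc \<sigma>c unfolding w_def e by (simp only: nat_pow_Suc2 m_assoc nat_pow_closed)
    then show ?thesis
      using \<sigma>(2) submonoid_pow[OF submonoid_reach \<sigma>(1)] T.m_closed by metis
  qed
  have pow: "x [^] k \<otimes> w [^] n \<in> reach" if "k \<le> n" for k
  proof -
    have "x [^] k \<otimes> w [^] n = x [^] k \<otimes> (w [^] k \<otimes> w [^] (n - k))"
      using that w(2) by (simp add: nat_pow_mult)
    also have "\<dots> = (x \<otimes> w) [^] k \<otimes> w [^] (n - k)"
      using pow_mult_distrib[OF w(3) xc w(2)] xc w(2) by (simp add: m_assoc)
    finally show ?thesis
      using submonoid_pow[OF submonoid_reach] xw w(1) T.m_closed by metis
  qed
  (* The conjugate of x seen from h is one of finitely many. For each of them, c y is a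
     reachable element that brings it back to x; this makes the set F below independent of h. *)
  define Y where "Y = (\<lambda>h. inv h \<otimes> x \<otimes> h) ` carrier G"
  have "Y \<subseteq> {g \<otimes> x \<otimes> inv g | g. g \<in> carrier G}"
    unfolding Y_def
  proof clarify
    fix h assume h: "h \<in> carrier G"
    then show "\<exists>g. inv h \<otimes> x \<otimes> h = g \<otimes> x \<otimes> inv g \<and> g \<in> carrier G"
      by (intro exI[of _ "inv h"]) simp
  qed
  then have fin: "finite Y"
    using x finite_subset unfolding fc_centre_def by blast
  have gen': "generate G reach = carrier G"
    using generate_supp_subset_generate_reach gen generate_incl[OF T.subset] by blast
  have "\<exists>\<tau>\<in>reach. inv \<tau> \<otimes> y \<otimes> \<tau> = x" if y: "y \<in> Y" for y
  proof -
    obtain h where h: "h \<in> carrier G" "y = inv h \<otimes> x \<otimes> h" using y unfolding Y_def by blast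
    have "inv (inv h) \<otimes> y \<otimes> inv h = x"
      using h xc by (simp add: m_assoc) (simp flip: m_assoc)
    then show ?thesis
      using conjugate_by_generating_submonoid[OF submonoid_reach gen', of "inv h" y] h fc_centre_conj[OF x h(1)]
      by auto
  qed
  then have "\<forall>y\<in>Y. \<exists>\<tau>. \<tau> \<in> reach \<and> inv \<tau> \<otimes> y \<otimes> \<tau> = x"
    by blast
  from bchoice[OF this] obtain c
    where c: "\<And>y. y \<in> Y \<Longrightarrow> c y \<in> reach" "\<And>y. y \<in> Y \<Longrightarrow> inv (c y) \<otimes> y \<otimes> c y = x"
    by blast
  define F where "F = (\<lambda>(y, k). c y \<otimes> (x [^] k \<otimes> w [^] n)) ` (Y \<times> {..<n})"
  have "F \<subseteq> reach" "finite F"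
    using c(1) pow T.m_closed fin by (auto simp: F_def)
  moreover have "M / 2 > 0"
    using \<open>M > 0\<close> by simp
  ultimately have "\<exists>\<epsilon>>0. \<forall>h\<in>carrier G. M - ?g h < \<epsilon> \<longrightarrow> (\<forall>\<tau>\<in>F. M - ?g (h \<otimes> \<tau>) < M / 2)"
    by (intro near_max_reach_finite[OF g M])
  then obtain \<epsilon> where \<epsilon>: "\<epsilon> > 0"
    "\<forall>h\<in>carrier G. M - ?g h < \<epsilon> \<longrightarrow> (\<forall>\<tau>\<in>F. M - ?g (h \<otimes> \<tau>) < M / 2)"
    by blast
  have "\<exists>h\<in>carrier G. M - \<epsilon> < ?g h"
    using \<gamma> \<epsilon>(1) by (subst less_cSUP_iff[OF _ bdd, symmetric]) (auto simp: M_def)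
  then obtain h where h: "h \<in> carrier G" "M - ?g h < \<epsilon>"
    by (auto simp: algebra_simps)
  define y where "y = inv h \<otimes> x \<otimes> h"
  have y: "y \<in> Y" "y \<in> carrier G" using h xc by (auto simp: y_def Y_def)
  define \<tau> where "\<tau> = c y"
  have \<tau>: "\<tau> \<in> carrier G" using c(1)[OF y(1)] reach_closed by (simp add: \<tau>_def)
  have "inv \<tau> \<otimes> (y \<otimes> \<tau>) = x"
    using c(2)[OF y(1)] y(2) \<tau> by (simp add: \<tau>_def m_assoc)
  then have y\<tau>: "y \<otimes> \<tau> = \<tau> \<otimes> x"
    using y(2) \<tau> xc by (simp add: inv_solve_left')
  (* moving by the conjugator reaches a point that commutes with x *)
  have "x \<otimes> h = h \<otimes> y"
    using inv_solve_left[of y h "x \<otimes> h"] h y(2) xc by (simp add: y_def m_assoc)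
  then have conj: "x \<otimes> (h \<otimes> \<tau>) = h \<otimes> \<tau> \<otimes> x"
    using h y(2) \<tau> xc y\<tau> by (metis m_assoc)
  let ?a = "\<lambda>k::nat. f (h \<otimes> \<tau> \<otimes> (x [^] k \<otimes> w [^] n))"
  have "M / 2 \<le> ?a k - ?a (Suc k)" if k: "k < n" for k :: nat
  proof -
    have "M - ?g (h \<otimes> (\<tau> \<otimes> (x [^] k \<otimes> w [^] n))) < M / 2"
    proof (rule \<epsilon>(2)[rule_format, OF h])
      show "\<tau> \<otimes> (x [^] k \<otimes> w [^] n) \<in> F"
        unfolding F_def \<tau>_def using k y(1) by (intro image_eqI[of _ _ "(y, k)"]) auto
    qed
    moreover have "h \<otimes> (\<tau> \<otimes> (x [^] k \<otimes> w [^] n)) = h \<otimes> \<tau> \<otimes> (x [^] k \<otimes> w [^] n)"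
      using h \<tau> xc w by (simp add: m_assoc)
    moreover have "x \<otimes> (h \<otimes> \<tau> \<otimes> (x [^] k \<otimes> w [^] n)) = h \<otimes> \<tau> \<otimes> (x [^] Suc k \<otimes> w [^] n)"
    proof -
      have "x \<otimes> (h \<otimes> \<tau> \<otimes> (x [^] k \<otimes> w [^] n)) = (x \<otimes> (h \<otimes> \<tau>)) \<otimes> (x [^] k \<otimes> w [^] n)"
        using h \<tau> xc w by (simp add: m_assoc)
      also have "\<dots> = h \<otimes> \<tau> \<otimes> (x \<otimes> x [^] k \<otimes> w [^] n)"
        unfolding conj using h \<tau> xc w by (simp add: m_assoc)
      finally show ?thesis
        using xc by (simp only: nat_pow_Suc2)
    qed
    ultimately show ?thesis by simp
  qed
  then have "real n * (M / 2) \<le> (\<Sum>k<n. ?a k - ?a (Suc k))"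
    using sum_bounded_below[of "{..<n}" "M / 2" "\<lambda>k. ?a k - ?a (Suc k)"] by simp
  also have "\<dots> = ?a 0 - ?a n"
    by (rule sum_lessThan_telescope')
  also have "\<dots> \<le> 2 * B"
  proof -
    have "\<bar>?a k\<bar> \<le> B" for k
      using h \<tau> xc w by (intro B) simp
    from this[of 0] this[of n] show ?thesis by linarith
  qed
  finally show False using n by linarith
qed

text \<open>
  The inequality just obtained holds for \<open>- f\<close> as well.
\<close>
lemma fc_centre_invariant:
  assumes gen: "generate G (set_pmf P) = carrier G"
    and f: "bounded (f ` carrier G)" "harmonic G P f"
    and x: "x \<in> fc_centre G" and \<sigma>: "\<sigma> \<in> reach" "x \<otimes> \<sigma> \<in> reach"
    and \<gamma>: "\<gamma> \<in> carrier G"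
  shows "f (x \<otimes> \<gamma>) = f \<gamma>"
  using fc_centre_nondecreasing[OF gen f x \<sigma> \<gamma>]
    fc_centre_nondecreasing[OF gen harmonic_minus[OF f] x \<sigma> \<gamma>] by simp

section \<open>Passing to quotients\<close>

lemma quotient_group_hom:
  assumes "H \<lhd> G"
  shows "group_hom G (G Mod H) (\<lambda>x. H #> x)"
  using assms
  by (intro group_hom.intro group_hom_axioms.intro normal.factorgroup_is_group
      normal.r_coset_hom_Mod is_group)

lemma quotient_random_walk:
  assumes "H \<lhd> G"
  shows "random_walk (G Mod H) (map_pmf (\<lambda>x. H #> x) P)"
proof -
  interpret \<phi>: group_hom G "G Mod H" "\<lambda>x. H #> x"
    using assms by (rule quotient_group_hom)
  show ?thesis
    by unfold_locales (use supp \<phi>.hom_closed in auto)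
qed

lemma harmonic_quotient_iff:
  assumes H: "H \<lhd> G" and F: "bounded (F ` carrier (G Mod H))"
  shows "harmonic (G Mod H) (map_pmf (\<lambda>x. H #> x) P) F \<longleftrightarrow> harmonic G P (\<lambda>\<gamma>. F (H #> \<gamma>))"
proof -
  interpret \<phi>: group_hom G "G Mod H" "\<lambda>x. H #> x"
    using H by (rule quotient_group_hom)
  interpret Q: random_walk "G Mod H" "map_pmf (\<lambda>x. H #> x) P"
    using H by (rule quotient_random_walk)
  have carr: "carrier (G Mod H) = (\<lambda>g. H #> g) ` carrier G"
    by (auto simp: carrier_FactGroup)
  have bdd: "bounded ((\<lambda>\<gamma>. F (H #> \<gamma>)) ` carrier G)"
    using F unfolding carr by (simp add: image_image)
  have "measure_pmf.expectation (map_pmf (\<lambda>x. H #> x) P)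
      (\<lambda>y. F ((H #> \<gamma>) \<otimes>\<^bsub>G Mod H\<^esub> inv\<^bsub>G Mod H\<^esub> y)) =
      measure_pmf.expectation P (\<lambda>y. F (H #> (\<gamma> \<otimes> inv y)))" if \<gamma>: "\<gamma> \<in> carrier G" for \<gamma>
    unfolding integral_map_pmf
  proof (rule integral_cong_AE)
    show "AE y in measure_pmf P. F ((H #> \<gamma>) \<otimes>\<^bsub>G Mod H\<^esub> inv\<^bsub>G Mod H\<^esub> (H #> y)) = F (H #> (\<gamma> \<otimes> inv y))"
    proof (rule AE_pmfI)
      fix y assume "y \<in> set_pmf P"
      then have "y \<in> carrier G" using supp by blast
      then show "F ((H #> \<gamma>) \<otimes>\<^bsub>G Mod H\<^esub> inv\<^bsub>G Mod H\<^esub> (H #> y)) = F (H #> (\<gamma> \<otimes> inv y))"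
        using \<gamma> by (metis \<phi>.hom_mult \<phi>.hom_inv inv_closed)
    qed
  qed simp_all
  then show ?thesis
    unfolding Q.harmonic_iff[OF F] harmonic_iff[OF bdd] carr by simp
qed

lemma invariant_descends:
  assumes H: "H \<lhd> G"
    and inv: "\<And>x \<gamma>. x \<in> H \<Longrightarrow> \<gamma> \<in> carrier G \<Longrightarrow> f (x \<otimes> \<gamma>) = f \<gamma>"
  obtains F where "\<And>\<gamma>. \<gamma> \<in> carrier G \<Longrightarrow> F (H #> \<gamma>) = f \<gamma>"
proof
  interpret H: normal H G by fact
  fix \<gamma> assume \<gamma>: "\<gamma> \<in> carrier G"
  let ?\<delta> = "inv_into (carrier G) (\<lambda>x. H #> x) (H #> \<gamma>)"
  have \<delta>: "?\<delta> \<in> carrier G" "H #> ?\<delta> = H #> \<gamma>"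
    using \<gamma> by (auto intro!: inv_into_into f_inv_into_f)
  then have "?\<delta> \<in> H #> \<gamma>"
    using rcos_self[OF \<delta>(1) H.is_subgroup] by simp
  then show "f ?\<delta> = f \<gamma>"
    using inv \<gamma> by (auto simp: r_coset_def)
qed

lemma reach_quotient:
  assumes H: "H \<lhd> G" and \<tau>: "\<tau> \<in> reach"
  shows "H #> \<tau> \<in> random_walk.reach (G Mod H) (map_pmf (\<lambda>x. H #> x) P)"
proof -
  interpret \<phi>: group_hom G "G Mod H" "\<lambda>x. H #> x"
    using H by (rule quotient_group_hom)
  interpret Q: random_walk "G Mod H" "map_pmf (\<lambda>x. H #> x) P"
    using H by (rule quotient_random_walk)
  interpret QT: submonoid Q.reach "G Mod H"
    by (rule Q.submonoid_reach)
  show ?thesis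
    using \<tau> unfolding reach_def
  proof induction
    case one
    show ?case using QT.one_closed \<phi>.hom_one by metis
  next
    case (snoc \<tau> s)
    then obtain r where r: "r \<in> set_pmf P" "s = inv r" by blast
    then have c: "r \<in> carrier G" "\<tau> \<in> carrier G"
      using supp snoc.hyps reach_closed unfolding reach_def by auto
    have "inv\<^bsub>G Mod H\<^esub> (H #> r) \<in> Q.reach"
      using r by (intro Q.inv_supp_reach) auto
    then have "H #> s \<in> Q.reach"
      using c r \<phi>.hom_inv by simp
    then have "(H #> \<tau>) \<otimes>\<^bsub>G Mod H\<^esub> (H #> s) \<in> Q.reach"
      using snoc.IH by (intro QT.m_closed)
    then show ?case
      using \<phi>.hom_mult[of \<tau> s] c r by simp
  qed
qed

section \<open>Invariance under the FC-hypercentre\<close>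

text \<open>
  The successor step: \<open>f\<close> descends to the quotient by \<open>H\<close>, where \<open>x\<close> becomes an element with finite
  conjugacy class and the reachable points map to reachable points.
\<close>
lemma fc_next_invariant:
  assumes gen: "generate G (set_pmf P) = carrier G"
    and f: "bounded (f ` carrier G)" "harmonic G P f"
    and H: "H \<lhd> G" and inv: "\<And>x \<gamma>. x \<in> H \<Longrightarrow> \<gamma> \<in> carrier G \<Longrightarrow> f (x \<otimes> \<gamma>) = f \<gamma>"
    and x: "x \<in> fc_next G H" and \<sigma>: "\<sigma> \<in> reach" "x \<otimes> \<sigma> \<in> reach"
    and \<gamma>: "\<gamma> \<in> carrier G"
  shows "f (x \<otimes> \<gamma>) = f \<gamma>"
proof -
  interpret \<phi>: group_hom G "G Mod H" "\<lambda>x. H #> x"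
    using H by (rule quotient_group_hom)
  interpret Q: random_walk "G Mod H" "map_pmf (\<lambda>x. H #> x) P"
    using H by (rule quotient_random_walk)
  have carr: "carrier (G Mod H) = (\<lambda>g. H #> g) ` carrier G"
    by (auto simp: carrier_FactGroup)
  obtain F where F: "\<And>\<gamma>. \<gamma> \<in> carrier G \<Longrightarrow> F (H #> \<gamma>) = f \<gamma>"
    using invariant_descends[of H f] H inv by blast
  have bdd: "bounded (F ` carrier (G Mod H))"
    using f(1) F unfolding carr by (simp add: image_image)
  have fF: "harmonic G P (\<lambda>\<gamma>. F (H #> \<gamma>))"
    using harmonic_cong[of "\<lambda>\<gamma>. F (H #> \<gamma>)" f P] F f(2) by simp
  have xc: "x \<in> carrier G" and xq: "H #> x \<in> fc_centre (G Mod H)"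
    using x by (auto simp: fc_next_def)
  have "generate (G Mod H) (set_pmf (map_pmf (\<lambda>x. H #> x) P)) = carrier (G Mod H)"
    using \<phi>.generate_img[OF supp] gen carr by simp
  moreover have "harmonic (G Mod H) (map_pmf (\<lambda>x. H #> x) P) F"
    using fF harmonic_quotient_iff[OF H bdd] by simp
  moreover have "(H #> x) \<otimes>\<^bsub>G Mod H\<^esub> (H #> \<sigma>) \<in> Q.reach"
    using reach_quotient[OF H \<sigma>(2)] \<phi>.hom_mult[OF xc reach_closed[OF \<sigma>(1)]] by simp
  ultimately have "F ((H #> x) \<otimes>\<^bsub>G Mod H\<^esub> (H #> \<gamma>)) = F (H #> \<gamma>)"
    using Q.fc_centre_invariant[OF _ bdd _ xq reach_quotient[OF H \<sigma>(1)] _ \<phi>.hom_closed[OF \<gamma>]]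
    by blast
  then show ?thesis
    using F[of "x \<otimes> \<gamma>"] F[OF \<gamma>] \<phi>.hom_mult[OF xc \<gamma>] xc \<gamma> by simp
qed

text \<open>
  The induction runs along \<open>N \<inter> Z\<close>, for \<open>Z\<close> in the FC-series, rather than along \<open>Z\<close>: only elements of
  \<open>N\<close> are known to be quotients of reachable points.
\<close>
lemma fc_hypercentral_invariant:
  fixes \<alpha> :: "'o::{wellorder, no_top}"
  assumes gen: "generate G (set_pmf P) = carrier G"
    and f: "bounded (f ` carrier G)" "harmonic G P f"
    and N: "N \<lhd> G" "N \<subseteq> fc_series G \<alpha>" and genN: "N \<subseteq> generate G (set_pmf P \<inter> N)"
    and x: "x \<in> N" and \<gamma>: "\<gamma> \<in> carrier G"
  shows "f (x \<otimes> \<gamma>) = f \<gamma>"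
proof -
  interpret N: normal N G by (rule N(1))
  interpret R: submonoid reach G by (rule submonoid_reach)
  have T: "submonoid (reach \<inter> N) G"
    by unfold_locales (use R.subset in auto)
  have sub: "subgroup (generate G (reach \<inter> N)) G"
    using R.subset by (intro generate_is_subgroup) auto
  have "m_inv G ` (set_pmf P \<inter> N) \<subseteq> generate G (reach \<inter> N)"
    using inv_supp_reach by (auto intro!: generate.incl)
  from generate_subgroup_incl[OF this sub]
  have "generate G (set_pmf P \<inter> N) \<subseteq> generate G (reach \<inter> N)"
    by (rule generate_subset_if_inverses[rotated, OF _ sub]) (use supp in auto)
  then have quot: "\<exists>\<sigma>\<in>reach. x \<otimes> \<sigma> \<in> reach" if "x \<in> N" for x
    using generate_submonoid_is_quotient[OF T, of \<alpha> x] that genN N(2) by blast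
  have "f (x \<otimes> \<gamma>) = f \<gamma>" if "x \<in> N" "x \<in> fc_series G \<beta>" "\<gamma> \<in> carrier G" for x \<gamma> and \<beta> :: 'o
    using that
  proof (induction \<beta> arbitrary: x \<gamma> rule: less_induct)
    case (less \<beta>)
    show ?case
    proof (cases \<beta> rule: ordinal_cases)
      case zero
      then have "x = \<one>"
        using less.prems(2) by (simp add: fc_series_zero)
      then show ?thesis using less.prems(3) by simp
    next
      case (successor \<kappa>)
      have Z: "fc_series G \<kappa> \<lhd> G"
        by (rule normal_fc_series) (rule is_group)
      have x: "x \<in> fc_next G (N \<inter> fc_series G \<kappa>)"
        using less.prems(1,2) by (intro fc_next_Int N(1) Z) (simp_all add: successor(2) fc_series_osuc)
      obtain \<sigma> where \<sigma>: "\<sigma> \<in> reach" "x \<otimes> \<sigma> \<in> reach"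
        using quot[OF less.prems(1)] by auto
      have inv: "f (y \<otimes> \<delta>) = f \<delta>"
        if "y \<in> N \<inter> fc_series G \<kappa>" "\<delta> \<in> carrier G" for y \<delta>
        using less.IH[OF successor(1), of y \<delta>] that by simp
      show ?thesis
        by (rule fc_next_invariant[OF gen f normal_subgroup_intersect[OF N(1) Z] inv x \<sigma> less.prems(3)])
    next
      case limit
      then have "fc_series G \<beta> = (\<Union>\<kappa>\<in>{..<\<beta>}. fc_series G \<kappa>)"
        by (rule fc_series_limit)
      then obtain \<kappa> where "\<kappa> < \<beta>" "x \<in> fc_series G \<kappa>"
        using less.prems(2) by auto
      then show ?thesis
        using less.IH[of \<kappa> x \<gamma>] less.prems by simp
    qed
  qed
  then show ?thesis using x N(2) \<gamma> by blast
qed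

text \<open>
  Harmonicity at \<open>\<gamma>\<close> says that \<open>f(\<gamma> y\<inverse>) - f(\<gamma>)\<close> has mean \<open>0\<close>. The term \<open>y = \<one>\<close> contributes nothing,
  and the remaining terms for \<open>P\<close> and \<open>Q\<close> differ by the factor \<open>c\<close>.
\<close>
lemma harmonic_proportional_iff:
  assumes Q: "random_walk G Q"
    and c: "c > 0" and eq: "\<And>y. y \<in> carrier G \<Longrightarrow> y \<noteq> \<one> \<Longrightarrow> pmf P y = c * pmf Q y"
    and f: "bounded (f ` carrier G)"
  shows "harmonic G P f \<longleftrightarrow> harmonic G Q f"
proof -
  interpret Q: random_walk G Q by fact
  have "measure_pmf.expectation P (\<lambda>y. f (\<gamma> \<otimes> inv y)) - f \<gamma> =
      c * (measure_pmf.expectation Q (\<lambda>y. f (\<gamma> \<otimes> inv y)) - f \<gamma>)" if \<gamma>: "\<gamma> \<in> carrier G" for \<gamma>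
  proof -
    let ?d = "\<lambda>y. f (\<gamma> \<otimes> inv y) - f \<gamma>"
    have "pmf P y * ?d y = c * (pmf Q y * ?d y)" for y
    proof (cases "y \<in> carrier G \<and> y \<noteq> \<one>")
      case False
      then have "y = \<one> \<or> pmf P y = 0 \<and> pmf Q y = 0"
        using supp Q.supp by (auto simp: set_pmf_iff)
      then show ?thesis using \<gamma> by auto
    qed (use eq in auto)
    then have "measure_pmf.expectation P ?d = infsetsum (\<lambda>y. c * (pmf Q y * ?d y)) UNIV"
      unfolding pmf_expectation_eq_infsetsum by (simp only:)
    also have "\<dots> = c * measure_pmf.expectation Q ?d"
      unfolding pmf_expectation_eq_infsetsum infsetsum_def by (rule integral_mult_right_zero)
    finally show ?thesis
      using integrable_step[OF f \<gamma>] Q.integrable_step[OF f \<gamma>] by simp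
  qed
  then show ?thesis
    unfolding harmonic_iff[OF f] Q.harmonic_iff[OF f] using c
    by (metis (no_types, lifting) eq_iff_diff_eq_0 less_irrefl mult_eq_0_iff)
qed

text \<open>
  A summand supported in \<open>N\<close> only contributes to the mass of the trivial coset.
\<close>
lemma pmf_map_quotient_eq_push_forward:
  assumes m: "\<And>x. pmf P x = m' x + m x"
    and m': "density_support (carrier G) m' \<subseteq> N" and N: "subgroup N G"
    and y: "y \<noteq> N"
  shows "pmf (map_pmf (\<lambda>x. N #> x) P) y = push_forward (carrier G) (\<lambda>x. N #> x) m y"
proof -
  have "pmf (map_pmf (\<lambda>x. N #> x) P) y = infsetsum (pmf P) ((\<lambda>x. N #> x) -` {y})"
    by (simp add: pmf_map measure_pmf_conv_infsetsum)
  also have "\<dots> = infsum (pmf P) ((\<lambda>x. N #> x) -` {y})"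
    by (rule infsetsum_infsum) (rule pmf_abs_summable)
  also have "\<dots> = push_forward (carrier G) (\<lambda>x. N #> x) m y"
    unfolding push_forward_def
  proof (rule infsum_cong_neutral)
    fix x assume "x \<in> (\<lambda>x. N #> x) -` {y} \<inter> {x \<in> carrier G. N #> x = y}"
    then have "x \<notin> N" "x \<in> carrier G"
      using y coset_join2[OF _ N] by auto
    then show "pmf P x = m x"
      using m' m[of x] by (auto simp: density_support_def)
  next
    fix x assume "x \<in> (\<lambda>x. N #> x) -` {y} - {x \<in> carrier G. N #> x = y}"
    then show "pmf P x = 0"
      using supp by (auto simp: set_pmf_iff)
  qed auto
  finally show ?thesis .
qed

end

section \<open>Liouville property of the group and of its quotient\<close>

theorem theorem3p9:
  fixes \<Gamma> :: "('a, 'b) monoid_scheme" (structure)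
    and N :: "'a set"
    and \<nu> :: "'a set pmf"
    and \<mu> :: "'a pmf"
    and \<mu>\<^sub>1 \<mu>\<^sub>2 :: "'a \<Rightarrow> real"
    and s t :: real
  assumes "group \<Gamma>" and "countable (carrier \<Gamma>)"
    and "N \<lhd> \<Gamma>" and "N \<subseteq> fc_hypercentre \<Gamma>"
    \<comment> \<open>the measure on the quotient\<close>
    and "set_pmf \<nu> \<subseteq> carrier (\<Gamma> Mod N)" and "finite (set_pmf \<nu>)"
    and "symmetric_pmf (\<Gamma> Mod N) \<nu>"
    and "generate (\<Gamma> Mod N) (set_pmf \<nu>) = carrier (\<Gamma> Mod N)"
    \<comment> \<open>the measure on the group and its decomposition\<close>
    and "set_pmf \<mu> \<subseteq> carrier \<Gamma>"
    and "generate \<Gamma> (set_pmf \<mu> \<inter> N) = N"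
    and "\<And>x. 0 \<le> \<mu>\<^sub>1 x" and "\<And>x. 0 \<le> \<mu>\<^sub>2 x"
    and "\<And>x. pmf \<mu> x = \<mu>\<^sub>1 x + \<mu>\<^sub>2 x"
    and "t = (\<Sum>\<^sub>\<infinity>x\<in>carrier \<Gamma>. \<mu>\<^sub>2 x)" and "t > 0"
    and "0 \<le> s" and "s < 1"
    and "\<And>y. y \<in> carrier (\<Gamma> Mod N) \<Longrightarrow>
           push_forward (carrier \<Gamma>) (\<lambda>x. N #> x) \<mu>\<^sub>2 y =
             t * (s * pmf (return_pmf \<one>\<^bsub>\<Gamma> Mod N\<^esub>) y + (1 - s) * pmf \<nu> y)"
    and "density_support (carrier \<Gamma>) \<mu>\<^sub>1 \<subseteq> N"
    and "\<And>\<alpha> :: countable_ordinal.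
           conjugation_invariant (\<Gamma> Mod fc_series \<Gamma> \<alpha>)
             ((\<lambda>x. fc_series \<Gamma> \<alpha> #> x) `
               (density_support (carrier \<Gamma>) \<mu>\<^sub>1 \<inter> fc_series \<Gamma> (osuc \<alpha>)))"
    and "(\<exists>S. finite S \<and> S \<subseteq> N \<and> generate \<Gamma> S = N) \<or>
         (\<exists>n\<ge>1. \<forall>\<alpha> :: countable_ordinal.
            generate \<Gamma> (set_pmf (convolution_power \<Gamma> \<mu> n) \<inter> N \<inter> fc_series \<Gamma> \<alpha>) =
              N \<inter> fc_series \<Gamma> \<alpha>)"
  shows "liouville \<Gamma> \<mu> \<longleftrightarrow> liouville (\<Gamma> Mod N) \<nu>"
proof -
  interpret random_walk \<Gamma> \<mu>
    using assms(1,9) by (intro random_walk.intro random_walk_axioms.intro)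
  note N = assms(3)
  interpret N: normal N \<Gamma> by (rule N)
  let ?Q = "\<Gamma> Mod N" and ?\<phi> = "\<lambda>x. N #> x"
  interpret \<phi>: group_hom \<Gamma> ?Q ?\<phi>
    using N by (rule quotient_group_hom)
  interpret Q: random_walk ?Q "map_pmf ?\<phi> \<mu>"
    using N by (rule quotient_random_walk)
  have \<nu>: "random_walk ?Q \<nu>"
    using assms(5) by (intro random_walk.intro random_walk_axioms.intro \<phi>.H.is_group)
  have carr: "carrier ?Q = ?\<phi> ` carrier \<Gamma>"
    by (auto simp: carrier_FactGroup)
  define c where "c = t * (1 - s)"
  have c: "c > 0"
    using assms(15,17) by (simp add: c_def)
  (* the atom of weight s and mu_1, which lives on N, only change the mass at the identity *)
  have off_one: "pmf (map_pmf ?\<phi> \<mu>) y = c * pmf \<nu> y"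
    if y: "y \<in> carrier ?Q" "y \<noteq> \<one>\<^bsub>?Q\<^esub>" for y
  proof -
    have "pmf (map_pmf ?\<phi> \<mu>) y = push_forward (carrier \<Gamma>) ?\<phi> \<mu>\<^sub>2 y"
      using y(2) by (intro pmf_map_quotient_eq_push_forward[OF assms(13,19) N.is_subgroup]) simp
    also have "\<dots> = t * (s * pmf (return_pmf \<one>\<^bsub>?Q\<^esub>) y + (1 - s) * pmf \<nu> y)"
      by (rule assms(18)) (rule y(1))
    also have "\<dots> = c * pmf \<nu> y"
      using y(2) by (simp add: c_def)
    finally show ?thesis .
  qed
  have same: "harmonic ?Q (map_pmf ?\<phi> \<mu>) F \<longleftrightarrow> harmonic ?Q \<nu> F" if "bounded (F ` carrier ?Q)" for F
    using Q.harmonic_proportional_iff[OF \<nu> c off_one that] .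
  (* the support generates N, and its image generates the quotient by N *)
  have gen: "generate \<Gamma> (set_pmf \<mu>) = carrier \<Gamma>"
  proof
    show "generate \<Gamma> (set_pmf \<mu>) \<subseteq> carrier \<Gamma>"
      using supp by (rule generate_incl)
    have L: "subgroup (generate \<Gamma> (set_pmf \<mu>)) \<Gamma>"
      using supp by (rule generate_is_subgroup)
    have NL: "N \<subseteq> generate \<Gamma> (set_pmf \<mu>)"
      using mono_generate[of "set_pmf \<mu> \<inter> N" "set_pmf \<mu>"] assms(10) by simp
    have img: "generate ?Q (set_pmf (map_pmf ?\<phi> \<mu>)) = ?\<phi> ` generate \<Gamma> (set_pmf \<mu>)"
      using \<phi>.generate_img[OF supp] by simp
    have "set_pmf \<nu> \<subseteq> generate ?Q (set_pmf (map_pmf ?\<phi> \<mu>))"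
    proof
      fix y assume y: "y \<in> set_pmf \<nu>"
      show "y \<in> generate ?Q (set_pmf (map_pmf ?\<phi> \<mu>))"
      proof (cases "y = \<one>\<^bsub>?Q\<^esub>")
        case True
        then show ?thesis by (simp only: generate.one)
      next
        case False
        then have "pmf (map_pmf ?\<phi> \<mu>) y \<noteq> 0"
          using off_one[of y] y c assms(5) by (auto simp: set_pmf_iff)
        then show ?thesis
          by (intro generate.incl) (simp add: set_pmf_iff del: set_map_pmf)
      qed
    qed
    moreover have "subgroup (generate ?Q (set_pmf (map_pmf ?\<phi> \<mu>))) ?Q"
      using Q.supp by (rule \<phi>.H.generate_is_subgroup)
    ultimately have "carrier ?Q \<subseteq> ?\<phi> ` generate \<Gamma> (set_pmf \<mu>)"
      using \<phi>.H.generate_subgroup_incl assms(8) img by metis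
    show "carrier \<Gamma> \<subseteq> generate \<Gamma> (set_pmf \<mu>)"
    proof
      fix \<gamma> assume \<gamma>: "\<gamma> \<in> carrier \<Gamma>"
      then have "?\<phi> \<gamma> \<in> ?\<phi> ` generate \<Gamma> (set_pmf \<mu>)"
        using \<open>carrier ?Q \<subseteq> _\<close> \<phi>.hom_closed by blast
      then obtain l where l: "l \<in> generate \<Gamma> (set_pmf \<mu>)" "?\<phi> \<gamma> = ?\<phi> l"
        by blast
      then have "\<gamma> \<in> N #> l"
        using rcos_self[OF \<gamma> N.is_subgroup] by simp
      then obtain n where "n \<in> N" "\<gamma> = n \<otimes> l"
        by (auto simp: r_coset_def)
      then show "\<gamma> \<in> generate \<Gamma> (set_pmf \<mu>)"
        using NL l(1) subgroup.m_closed[OF L] by blast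
    qed
  qed
  obtain \<alpha> :: countable_ordinal where \<alpha>: "N \<subseteq> fc_series \<Gamma> \<alpha>"
  proof -
    obtain \<alpha> :: countable_ordinal where "\<forall>\<beta>\<ge>\<alpha>. fc_series \<Gamma> \<beta> = fc_series \<Gamma> \<alpha>"
      using fc_series_stabilises[OF assms(1,2)] by blast
    then have "fc_hypercentre \<Gamma> = fc_series \<Gamma> \<alpha>"
      by (intro fc_hypercentre_eq) blast
    then show ?thesis
      using assms(4) that by blast
  qed
  show ?thesis
  proof
    assume L: "liouville \<Gamma> \<mu>"
    show "liouville ?Q \<nu>"
      unfolding liouville_def
    proof (intro allI impI, elim conjE)
      fix F assume F: "bounded (F ` carrier ?Q)" "harmonic ?Q \<nu> F"
      have "harmonic \<Gamma> \<mu> (\<lambda>\<gamma>. F (N #> \<gamma>))"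
        using harmonic_quotient_iff[OF N F(1)] same[OF F(1)] F(2) by simp
      moreover have "bounded ((\<lambda>\<gamma>. F (N #> \<gamma>)) ` carrier \<Gamma>)"
        using F(1) unfolding carr by (simp add: image_image)
      ultimately obtain k where "\<forall>\<gamma>\<in>carrier \<Gamma>. F (N #> \<gamma>) = k"
        using L unfolding liouville_def by meson
      then show "\<exists>k. \<forall>\<gamma>\<in>carrier ?Q. F \<gamma> = k"
        unfolding carr by auto
    qed
  next
    assume L: "liouville ?Q \<nu>"
    show "liouville \<Gamma> \<mu>"
      unfolding liouville_def
    proof (intro allI impI, elim conjE)
      fix f assume f: "bounded (f ` carrier \<Gamma>)" "harmonic \<Gamma> \<mu> f"
      have inv: "f (x \<otimes> \<gamma>) = f \<gamma>" if "x \<in> N" "\<gamma> \<in> carrier \<Gamma>" for x \<gamma>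
        by (rule fc_hypercentral_invariant[OF gen f N \<alpha> _ that]) (simp add: assms(10))
      obtain F where F: "\<And>\<gamma>. \<gamma> \<in> carrier \<Gamma> \<Longrightarrow> F (N #> \<gamma>) = f \<gamma>"
        using invariant_descends[OF N inv] by blast
      have bdd: "bounded (F ` carrier ?Q)"
        using f(1) F unfolding carr by (simp add: image_image)
      have "harmonic \<Gamma> \<mu> (\<lambda>\<gamma>. F (N #> \<gamma>))"
        using harmonic_cong[of "\<lambda>\<gamma>. F (N #> \<gamma>)" f \<mu>] F f(2) by simp
      then have "harmonic ?Q \<nu> F"
        using harmonic_quotient_iff[OF N bdd] same[OF bdd] by simp
      then obtain k where "\<forall>y\<in>carrier ?Q. F y = k"
        using L bdd unfolding liouville_def by meson
      then show "\<exists>k. \<forall>\<gamma>\<in>carrier \<Gamma>. f \<gamma> = k"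
        using F \<phi>.hom_closed by metis
    qed
  qed
qed

end
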